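(* Let $m,\ell$ be positive integers and $r\ge2$. Let $X$ be an $n$-dimensional compact $C^r$ manifold with $\ell>2n$, let $V$ be an open subset of $\mathbb{R}^m$, let $f:X\to V$ be a $C^r$ embedding, and let $g:V\to\mathbb{R}^\ell$ be a $C^r$ mapping. Set $$\Sigma=\{\pi\in\mathcal{L}(\mathbb{R}^m,\mathbb{R}^\ell)\mid (g+\pi)\circ f:X\to\mathbb{R}^\ell \text{ is not an embedding}\}.$$ Then, for any real number $s$ satisfying $$s>m\ell+2n-\ell,$$ the set $\Sigma$ has $s$-dimensional Hausdorff measure zero in $\mathcal{L}(\mathbb{R}^m,\mathbb{R}^\ell)$.
   Context: All manifolds are without boundary and second countable; the differentiability class $r$ is an integer or $\infty$. $\mathcal{L}(\mathbb{R}^m,\mathbb{R}^\ell)$ is the space of all linear mappings $\mathbb{R}^m\to\mathbb{R}^\ell$, identified with the Euclidean space $(\mathbb{R}^m)^\ell=\mathbb{R}^{m\ell}$ via matrix entries. In $g+\pi$, the linear map $\pi$ is restricted to $V$. An embedding is an immersion that is a homeomorphism onto its image. For $s>0$, the $s$-dimensional Hausdorff outer measure of $B\subset\mathbb{R}^N$ is $\lim_{\delta\to0}\inf\{\sum_{j=1}^\infty(\operatorname{diam}C_j)^s\mid B\subset\bigcup_{j=1}^\infty C_j,\ \operatorname{diam}C_j\le\delta\}$ (Euclidean diameter, arbitrary subsets $C_j$ of $\mathbb{R}^N$); for $s=0$ it is the counting measure. A subset of $\mathcal{L}(\mathbb{R}^m,\mathbb{R}^\ell)$ has $s$-dimensional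 Hausdorff measure zero if its $s$-dimensional Hausdorff outer measure in $\mathbb{R}^{m\ell}$ is zero. *)

theory Defs
  imports "HOL-Analysis.Analysis" "HOL-Library.Extended_Nat"
begin

section \<open>Mappings of class \<open>C\<^sup>r\<close>\<close>

text \<open>
  A point of Euclidean space is given by its coordinate function \<open>'i \<Rightarrow> real\<close>, where only the
  coordinates in an index set \<open>I\<close> vary. Both \<open>Euclidean_space n\<close> (with \<open>I = {..<n}\<close>, including
  \<open>n = 0\<close>) and \<open>real ^ 'm\<close> (with \<open>I = UNIV\<close>, via \<^const>\<open>vec_nth\<close>) are covered.
\<close>

definition partial_deriv ::
    "'i \<Rightarrow> (('i \<Rightarrow> real) \<Rightarrow> 'b::real_normed_vector) \<Rightarrow> ('i \<Rightarrow> real) \<Rightarrow> 'b" where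
  "partial_deriv i F x = vector_derivative (\<lambda>t. F (x(i := t))) (at (x i))"

text \<open>
  The set \<open>U\<close> is meant to be open in the space of the coordinates in \<open>I\<close>. The type-class topology
  on \<open>'i \<Rightarrow> real\<close> is the product topology, so on \<open>U\<close> it is the Euclidean one.
\<close>

primrec Ck_on :: "nat \<Rightarrow> 'i set \<Rightarrow> ('i \<Rightarrow> real) set \<Rightarrow>
    (('i \<Rightarrow> real) \<Rightarrow> 'b::real_normed_vector) \<Rightarrow> bool" where
  "Ck_on 0 I U F \<longleftrightarrow> continuous_on U F"
| "Ck_on (Suc k) I U F \<longleftrightarrow> continuous_on U F \<and>
     (\<forall>i\<in>I. (\<forall>x\<in>U. (\<lambda>t. F (x(i := t))) differentiable at (x i)) \<and>
             Ck_on k I U (partial_deriv i F))"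

definition Cr_on :: "enat \<Rightarrow> 'i set \<Rightarrow> ('i \<Rightarrow> real) set \<Rightarrow>
    (('i \<Rightarrow> real) \<Rightarrow> 'b::real_normed_vector) \<Rightarrow> bool" where
  "Cr_on r I U F \<longleftrightarrow> (\<forall>k. enat k \<le> r \<longrightarrow> Ck_on k I U F)"

definition Cr_on_vec :: "enat \<Rightarrow> (real ^ 'm) set \<Rightarrow>
    (real ^ 'm \<Rightarrow> 'b::real_normed_vector) \<Rightarrow> bool" where
  "Cr_on_vec r V g \<longleftrightarrow> Cr_on r UNIV (vec_nth ` V) (g \<circ> vec_lambda)"


section \<open>Manifolds of class \<open>C\<^sup>r\<close>\<close>

type_synonym 'x chart = "'x set \<times> ('x \<Rightarrow> nat \<Rightarrow> real)"

definition is_chart :: "nat \<Rightarrow> 'x topology \<Rightarrow> 'x chart \<Rightarrow> bool" where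
  "is_chart n X = (\<lambda>(U, \<phi>). openin X U \<and> openin (Euclidean_space n) (\<phi> ` U) \<and>
     homeomorphic_map (subtopology X U) (subtopology (Euclidean_space n) (\<phi> ` U)) \<phi>)"

text \<open>
  The atlas \<open>A\<close> represents the differentiable structure; it is not required to be maximal.
\<close>

definition Cr_manifold :: "enat \<Rightarrow> nat \<Rightarrow> 'x topology \<Rightarrow> 'x chart set \<Rightarrow> bool" where
  "Cr_manifold r n X A \<longleftrightarrow>
     Hausdorff_space X \<and> second_countable X \<and>
     (\<forall>c\<in>A. is_chart n X c) \<and> (\<Union>(U, \<phi>)\<in>A. U) = topspace X \<and>
     (\<forall>(U, \<phi>)\<in>A. \<forall>(W, \<psi>)\<in>A. \<forall>j<n.
        Cr_on r {..<n} (\<phi> ` (U \<inter> W)) (\<lambda>p. \<psi> (inv_into U \<phi> p) j))"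

definition Cr_map :: "enat \<Rightarrow> nat \<Rightarrow> 'x chart set \<Rightarrow> ('x \<Rightarrow> 'b::real_normed_vector) \<Rightarrow> bool" where
  "Cr_map r n A h \<longleftrightarrow> (\<forall>(U, \<phi>)\<in>A. Cr_on r {..<n} (\<phi> ` U) (h \<circ> inv_into U \<phi>))"

definition coord_differential ::
    "nat \<Rightarrow> ((nat \<Rightarrow> real) \<Rightarrow> 'b::real_normed_vector) \<Rightarrow> (nat \<Rightarrow> real) \<Rightarrow> (nat \<Rightarrow> real) \<Rightarrow> 'b" where
  "coord_differential n F p v = (\<Sum>i<n. v i *\<^sub>R partial_deriv i F p)"

definition Cr_immersion :: "enat \<Rightarrow> nat \<Rightarrow> 'x chart set \<Rightarrow> ('x \<Rightarrow> 'b::real_normed_vector) \<Rightarrow> bool" where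
  "Cr_immersion r n A h \<longleftrightarrow> Cr_map r n A h \<and>
     (\<forall>(U, \<phi>)\<in>A. \<forall>x\<in>U.
        inj_on (coord_differential n (h \<circ> inv_into U \<phi>) (\<phi> x)) (topspace (Euclidean_space n)))"

definition Cr_embedding ::
    "enat \<Rightarrow> nat \<Rightarrow> 'x topology \<Rightarrow> 'x chart set \<Rightarrow> ('x \<Rightarrow> 'b::real_normed_vector) \<Rightarrow> bool" where
  "Cr_embedding r n X A h \<longleftrightarrow> Cr_immersion r n A h \<and> embedding_map X euclidean h"


section \<open>Hausdorff outer measure\<close>

text \<open>
  Boundedness of the covering sets is required explicitly because \<^const>\<open>diameter\<close> is not
  meaningful on unbounded sets. Note that \<open>0 powr s = 0\<close>, so sets of diameter 0 contribute nothing
  for \<open>s > 0\<close>. Only \<open>s \<ge> 0\<close> is meaningful.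
\<close>

definition hausdorff_pre_measure :: "real \<Rightarrow> real \<Rightarrow> 'a::metric_space set \<Rightarrow> ennreal" where
  "hausdorff_pre_measure s \<delta> B =
     (INF C \<in> {C :: nat \<Rightarrow> 'a set. B \<subseteq> (\<Union>j. C j) \<and> (\<forall>j. bounded (C j) \<and> diameter (C j) \<le> \<delta>)}.
        \<Sum>j. ennreal (diameter (C j) powr s))"

definition hausdorff_outer_measure :: "real \<Rightarrow> 'a::metric_space set \<Rightarrow> ennreal" where
  "hausdorff_outer_measure s B =
     (if s = 0 then emeasure (count_space UNIV) B
      else Lim (at_right 0) (\<lambda>\<delta>. hausdorff_pre_measure s \<delta> B))"

text \<open>
  Linear mappings are identified with points of \<open>real ^ 'm ^ 'l\<close> through \<^const>\<open>matrix\<close>; the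
  metric of that type is the Euclidean metric in the matrix entries.
\<close>

definition linear_maps_hausdorff_null :: "real \<Rightarrow> (real ^ 'm \<Rightarrow> real ^ 'l) set \<Rightarrow> bool" where
  "linear_maps_hausdorff_null s S \<longleftrightarrow>
     hausdorff_outer_measure s (matrix ` S :: (real ^ 'm ^ 'l) set) = 0"

end

theory Submission
  imports Defs
begin

text \<open>
  Write \<open>h = (g + \<pi>) \<circ> f\<close>. As \<open>X\<close> is compact, \<open>h\<close> is an embedding as soon as it is an injective
  immersion, so a linear map \<open>\<pi>\<close> with matrix \<open>M\<close> is bad only for one of two reasons: two points
  \<open>x \<noteq> y\<close> have the same image, or the differential of \<open>h\<close> at some \<open>p\<close> kills a vector \<open>v \<noteq> 0\<close>. Both
  reasons are incidence conditions \<open>M a = b\<close>. In the first one \<open>a = f x - f y\<close> and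
  \<open>b = g (f y) - g (f x)\<close>; in the second one \<open>a\<close> and \<open>- b\<close> are the derivatives of \<open>f\<close> and of
  \<open>g \<circ> f\<close> at \<open>p\<close> in the direction \<open>v\<close>. In both cases \<open>a \<noteq> 0\<close>, because \<open>f\<close> is an injective
  immersion, and \<open>(a, b)\<close> is a locally Lipschitz function of \<open>2 n\<close> real parameters, namely the
  coordinates of \<open>(x, y)\<close> or of \<open>(p, v)\<close>. The second case differentiates \<open>f\<close> and \<open>g\<close> once before
  asking for a Lipschitz bound, which is where \<open>r \<ge> 2\<close> enters.

  Where the \<open>k\<close>-th coordinate of \<open>a\<close> is bounded away from zero, the equation \<open>M a = b\<close> can be solved
  for the \<open>k\<close>-th column of \<open>M\<close> (\<open>incidence_Lipschitz\<close>). Hence the matrices that satisfy the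
  condition for some parameter are a countable union of Lipschitz images of bounded sets described
  by \<open>2 n + (m - 1) \<ell>\<close> real coordinates: the parameters and the entries of \<open>M\<close> outside that column.
  Cutting coordinate space into cubes shows that such an image has \<open>s\<close>-dimensional measure zero for
  every \<open>s > 2 n + (m - 1) \<ell> = m \<ell> + 2 n - \<ell>\<close> (\<open>hausdorff_null_Lipschitz_image\<close>). This gives
  \<open>incidence_null\<close> and its two instances \<open>double_points_null\<close> and \<open>critical_points_null\<close>.

  Null sets are closed under countable unions only, whereas the atlas may be uncountable and the
  immersion condition has to hold in each of its charts. A finite subatlas that covers \<open>X\<close> is
  therefore chosen, and the chain rule carries the immersion condition from these charts to all the
  others (\<open>coord_differential_transition\<close>). The chain rule, local Lipschitz continuity and the
  stability of \<open>C\<^sup>k\<close> under composition are derived from iterated partial derivatives by a mean value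
  estimate that changes one coordinate at a time.
\<close>

section \<open>Sets of Hausdorff measure zero\<close>

text \<open>
  Vanishing of the outer measure in terms of explicit covers. One \<open>\<epsilon>\<close> bounds both the mesh and the
  total size of the cover; this loses nothing, because both bounds may be made arbitrarily small.
\<close>

definition hausdorff_null :: "real \<Rightarrow> 'a::metric_space set \<Rightarrow> bool" where
  "hausdorff_null s B \<longleftrightarrow> (\<forall>\<epsilon>>0. \<exists>C :: nat \<Rightarrow> 'a set. B \<subseteq> (\<Union>j. C j) \<and>
     (\<forall>j. bounded (C j) \<and> diameter (C j) \<le> \<epsilon>) \<and> (\<Sum>j. ennreal (diameter (C j) powr s)) \<le> ennreal \<epsilon>)"

lemma hausdorff_null_subset: "hausdorff_null s B \<Longrightarrow> A \<subseteq> B \<Longrightarrow> hausdorff_null s A"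
  unfolding hausdorff_null_def by (meson order_trans)

lemma hausdorff_outer_measure_eq_0:
  assumes "s \<noteq> 0" "hausdorff_null s B"
  shows "hausdorff_outer_measure s B = 0"
proof -
  have "hausdorff_pre_measure s \<delta> B = 0" if "\<delta> > 0" for \<delta>
  proof -
    have le: "hausdorff_pre_measure s \<delta> B \<le> ennreal e" if e: "e > 0" for e
    proof -
      obtain C :: "nat \<Rightarrow> _ set" where C: "B \<subseteq> (\<Union>j. C j)"
        "\<And>j. bounded (C j) \<and> diameter (C j) \<le> min e \<delta>"
        "(\<Sum>j. ennreal (diameter (C j) powr s)) \<le> ennreal (min e \<delta>)"
        using assms(2) e \<open>\<delta> > 0\<close> unfolding hausdorff_null_def by (metis min_less_iff_conj)
      have "hausdorff_pre_measure s \<delta> B \<le> (\<Sum>j. ennreal (diameter (C j) powr s))"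
        unfolding hausdorff_pre_measure_def using C(1,2) by (intro INF_lower) auto
      also have "\<dots> \<le> ennreal e" using C(3) by (rule order_trans) (auto intro: ennreal_leI)
      finally show ?thesis .
    qed
    have "hausdorff_pre_measure s \<delta> B \<le> 0"
    proof (rule ennreal_le_epsilon)
      fix e :: real assume "0 < e"
      then show "hausdorff_pre_measure s \<delta> B \<le> 0 + ennreal e" using le by simp
    qed
    then show ?thesis by simp
  qed
  then have "\<forall>\<^sub>F \<delta> in at_right 0. hausdorff_pre_measure s \<delta> B = 0"
    by (auto simp: eventually_at_right_less intro: eventually_at_rightI[of 0 1])
  then have "((\<lambda>\<delta>. hausdorff_pre_measure s \<delta> B) \<longlongrightarrow> 0) (at_right 0)"
    by (rule tendsto_eventually)
  then show ?thesis using assms(1) unfolding hausdorff_outer_measure_def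
    by (simp add: tendsto_Lim)
qed

text \<open>
  The usual \<open>\<epsilon> / 2\<^sup>i\<close> argument: the \<open>i\<close>-th set gets a cover of total size at most \<open>\<epsilon> / 2\<^bsup>i+1\<^esup>\<close>, and
  the double sequence of covering sets is enumerated by \<^const>\<open>prod_decode\<close>.
\<close>

lemma hausdorff_null_UN_nat:
  fixes B :: "nat \<Rightarrow> 'a::metric_space set"
  assumes "\<And>i. hausdorff_null s (B i)"
  shows "hausdorff_null s (\<Union>i. B i)"
  unfolding hausdorff_null_def
proof (intro allI impI)
  fix \<epsilon> :: real assume \<epsilon>: "\<epsilon> > 0"
  define e where "e i = \<epsilon> * (1/2) ^ Suc i" for i :: nat
  have e: "e i > 0" "e i \<le> \<epsilon>" for i
    using \<epsilon> power_le_one[of "1/2 :: real" "Suc i"] by (auto simp: e_def intro: mult_left_le)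
  have "\<exists>C :: nat \<Rightarrow> 'a set. B i \<subseteq> (\<Union>j. C j) \<and> (\<forall>j. bounded (C j) \<and> diameter (C j) \<le> e i) \<and>
      (\<Sum>j. ennreal (diameter (C j) powr s)) \<le> ennreal (e i)" for i
    using assms[of i] e(1)[of i] unfolding hausdorff_null_def by blast
  then obtain C :: "nat \<Rightarrow> nat \<Rightarrow> 'a set" where C: "\<And>i. B i \<subseteq> (\<Union>j. C i j)"
    "\<And>i j. bounded (C i j) \<and> diameter (C i j) \<le> e i"
    "\<And>i. (\<Sum>j. ennreal (diameter (C i j) powr s)) \<le> ennreal (e i)"
    by metis
  define C' where "C' k = (case prod_decode k of (i, j) \<Rightarrow> C i j)" for k
  have "(\<Union>i. B i) \<subseteq> (\<Union>k. C' k)"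
  proof
    fix x assume "x \<in> (\<Union>i. B i)"
    then obtain i j where "x \<in> C i j" using C(1) by blast
    then have "x \<in> C' (prod_encode (i, j))" by (simp add: C'_def)
    then show "x \<in> (\<Union>k. C' k)" by blast
  qed
  moreover have "bounded (C' k) \<and> diameter (C' k) \<le> \<epsilon>" for k
    using C(2) e(2) by (auto simp: C'_def split: prod.split intro: order_trans)
  moreover have "(\<Sum>k. ennreal (diameter (C' k) powr s)) \<le> ennreal \<epsilon>"
  proof -
    define f where "f = (\<lambda>(i, j). ennreal (diameter (C i j) powr s))"
    have "ennreal (diameter (C' k) powr s) = f (prod_decode k)" for k
      by (simp add: f_def C'_def split: prod.split)
    then have "(\<Sum>k. ennreal (diameter (C' k) powr s)) = (\<Sum>k. f (prod_decode k))" by simp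
    also have "\<dots> = (\<Sum>i. \<Sum>j. ennreal (diameter (C i j) powr s))"
      by (rule suminf_ennreal_2dimen) (simp add: f_def)
    also have "\<dots> \<le> (\<Sum>i. ennreal (e i))" by (intro suminf_le C(3)) auto
    also have "\<dots> = ennreal \<epsilon>"
    proof (rule suminf_ennreal_eq)
      show "e sums \<epsilon>" using sums_mult[OF power_half_series, of \<epsilon>] unfolding e_def by simp
    qed (use e(1) in \<open>auto intro: less_imp_le\<close>)
    finally show ?thesis .
  qed
  ultimately show "\<exists>C. (\<Union>i. B i) \<subseteq> (\<Union>j. C j) \<and> (\<forall>j. bounded (C j) \<and> diameter (C j) \<le> \<epsilon>) \<and>
      (\<Sum>j. ennreal (diameter (C j) powr s)) \<le> ennreal \<epsilon>" by blast
qed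

lemma hausdorff_null_empty: "hausdorff_null s {}"
  unfolding hausdorff_null_def by (auto intro!: exI[of _ "\<lambda>_. {}"])

lemma hausdorff_null_UN:
  assumes "countable I" "\<And>i. i \<in> I \<Longrightarrow> hausdorff_null s (B i)"
  shows "hausdorff_null s (\<Union>i\<in>I. B i)"
proof (cases "I = {}")
  case False
  have "hausdorff_null s (\<Union>k. B (from_nat_into I k))"
    by (intro hausdorff_null_UN_nat assms(2) from_nat_into False)
  moreover have "(\<Union>i\<in>I. B i) \<subseteq> (\<Union>k. B (from_nat_into I k))"
    using from_nat_into_surj[OF assms(1)] by (metis (no_types, lifting) SUP_least UNIV_I UN_upper)
  ultimately show ?thesis by (rule hausdorff_null_subset)
qed (simp add: hausdorff_null_empty)

lemma hausdorff_null_finite_coverI: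
  assumes "s > 0"
    and "\<And>\<epsilon>. \<epsilon> > 0 \<Longrightarrow> \<exists>(K :: 'k set) C D. finite K \<and> B \<subseteq> (\<Union>k\<in>K. C k) \<and>
      (\<forall>k\<in>K. \<forall>x\<in>C k. \<forall>y\<in>C k. dist x y \<le> D) \<and> 0 \<le> D \<and> D \<le> \<epsilon> \<and> real (card K) * D powr s \<le> \<epsilon>"
  shows "hausdorff_null s B"
  unfolding hausdorff_null_def
proof (intro allI impI)
  fix \<epsilon> :: real assume "\<epsilon> > 0"
  from assms(2)[OF this] obtain K :: "'k set" and C D where
    K: "finite K" "B \<subseteq> (\<Union>k\<in>K. C k)" "\<And>k x y. k \<in> K \<Longrightarrow> x \<in> C k \<Longrightarrow> y \<in> C k \<Longrightarrow> dist x y \<le> D"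
    and D: "0 \<le> D" "D \<le> \<epsilon>" "real (card K) * D powr s \<le> \<epsilon>" by metis
  obtain h where h: "bij_betw h {0..<card K} K" using ex_bij_betw_nat_finite[OF K(1)] by blast
  define C' where "C' j = (if j < card K then C (h j) else {})" for j
  have C'D: "dist x y \<le> D" if "x \<in> C' j" "y \<in> C' j" for x y j
    using that K(3)[of "h j" x y] bij_betwE[OF h] by (auto simp: C'_def split: if_splits)
  have bd: "bounded (C' j)" for j
    unfolding bounded_def using C'D[of _ j] by (metis (full_types))
  have diam: "diameter (C' j) \<le> D" for j
    unfolding diameter_def using D(1) C'D by (auto intro!: cSUP_least)
  have "B \<subseteq> (\<Union>j. C' j)"
  proof
    fix x assume "x \<in> B"
    then obtain k where "k \<in> K" "x \<in> C k" using K(2) by blast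
    then obtain j where "j < card K" "h j = k"
      using h by (metis atLeastLessThan_iff bij_betw_iff_bijections)
    then have "x \<in> C' j" using \<open>x \<in> C k\<close> by (simp add: C'_def)
    then show "x \<in> (\<Union>j. C' j)" by blast
  qed
  moreover have "(\<Sum>j. ennreal (diameter (C' j) powr s)) \<le> ennreal \<epsilon>"
  proof -
    have "(\<Sum>j. ennreal (diameter (C' j) powr s)) = (\<Sum>j<card K. ennreal (diameter (C' j) powr s))"
      by (rule suminf_finite) (auto simp: C'_def)
    also have "\<dots> \<le> (\<Sum>j<card K. ennreal (D powr s))"
      using diam assms(1) diameter_ge_0[OF bd] by (intro sum_mono ennreal_leI powr_mono2) auto
    also have "\<dots> = ennreal (real (card K) * D powr s)"
      by (simp add: ennreal_mult'' ennreal_of_nat_eq_real_of_nat[symmetric])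
    also have "\<dots> \<le> ennreal \<epsilon>" using D(3) by (rule ennreal_leI)
    finally show ?thesis .
  qed
  ultimately show "\<exists>C. B \<subseteq> (\<Union>j. C j) \<and> (\<forall>j. bounded (C j) \<and> diameter (C j) \<le> \<epsilon>) \<and>
      (\<Sum>j. ennreal (diameter (C j) powr s)) \<le> ennreal \<epsilon>"
    using bd diam D(2) by (intro exI[of _ C']) (auto intro: order_trans)
qed

text \<open>
  A bounded set seen through \<open>d\<close> real coordinates falls into \<open>O (N\<^sup>d)\<close> cells on which each coordinate
  varies by at most \<open>O (1 / N)\<close>. The images of these cells have diameter \<open>O (1 / N)\<close>, so that their
  total \<open>s\<close>-dimensional size is \<open>O (N\<^bsup>d - s\<^esup>)\<close>, which tends to \<open>0\<close> for \<open>s > d\<close>. The parameters may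
  have any type and only their coordinates \<open>c\<close> matter; later a parameter is a pair of an incidence
  and a matrix, and \<open>F\<close> is the projection to the matrix.
\<close>

lemma hausdorff_null_Lipschitz_image:
  fixes F :: "'p \<Rightarrow> 'a::metric_space" and c :: "'j \<Rightarrow> 'p \<Rightarrow> real"
  assumes J: "finite J" "real (card J) < s"
    and R: "\<And>p j. p \<in> P \<Longrightarrow> j \<in> J \<Longrightarrow> \<bar>c j p\<bar> \<le> R"
    and L: "\<And>p q. p \<in> P \<Longrightarrow> q \<in> P \<Longrightarrow> dist (F p) (F q) \<le> L * (\<Sum>j\<in>J. \<bar>c j p - c j q\<bar>)"
  shows "hausdorff_null s (F ` P)"
proof (rule hausdorff_null_finite_coverI)
  show "s > 0" using J(2) by linarith
  define d where "d = card J"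
  \<comment> \<open>Replacing \<open>R\<close> by \<open>\<bar>R\<bar> + 1\<close> makes the scaling by \<open>N / R1\<close> below meaningful when \<open>P\<close> is empty or \<open>R = 0\<close>.\<close>
  define R1 where "R1 = \<bar>R\<bar> + 1"
  define A where "A = \<bar>L\<bar> * d * R1"
  have R1: "R1 > 0" "A \<ge> 0" by (auto simp: R1_def A_def)
  fix \<epsilon> :: real assume \<epsilon>: "\<epsilon> > 0"
  have "(\<lambda>N. (3 ^ d * A powr s) * real (Suc N) powr (real d - s)) \<longlonglongrightarrow> (3 ^ d * A powr s) * 0"
    using J(2) by (intro tendsto_mult tendsto_const tendsto_neg_powr filterlim_compose[OF filterlim_real_sequentially filterlim_Suc]) (auto simp: d_def)
  then have "\<forall>\<^sub>F N in sequentially. (3 ^ d * A powr s) * real (Suc N) powr (real d - s) < \<epsilon>"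
    using \<epsilon> by (auto simp: order_tendsto_iff)
  moreover have "(\<lambda>N. A / real (Suc N)) \<longlonglongrightarrow> 0"
    using LIMSEQ_Suc[OF lim_const_over_n[of A]] .
  then have "\<forall>\<^sub>F N in sequentially. A / real (Suc N) < \<epsilon>" using \<epsilon> by (auto simp: order_tendsto_iff)
  ultimately have "\<exists>N. (3 ^ d * A powr s) * real (Suc N) powr (real d - s) < \<epsilon> \<and> A / real (Suc N) < \<epsilon>"
    using eventually_happens[OF eventually_conj] by fastforce
  then obtain N' where N': "(3 ^ d * A powr s) * real (Suc N') powr (real d - s) < \<epsilon>" "A / real (Suc N') < \<epsilon>"
    by blast
  define N where "N = Suc N'"
  have N: "N \<ge> 1" by (simp add: N_def)
  \<comment> \<open>A cell consists of the parameters whose rescaled coordinates have prescribed integer parts.\<close>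
  define K where "K = (\<Pi>\<^sub>E j\<in>J. {- int N..int N})"
  define idx where "idx p = (\<lambda>j\<in>J. \<lfloor>c j p * N / R1\<rfloor>)" for p
  define C where "C k = F ` {p \<in> P. idx p = k}" for k
  define D where "D = A / N"
  have idx: "idx p \<in> K" if "p \<in> P" for p
  proof -
    have "- int N \<le> \<lfloor>c j p * N / R1\<rfloor> \<and> \<lfloor>c j p * N / R1\<rfloor> \<le> int N" if "j \<in> J" for j
    proof -
      have "\<bar>c j p\<bar> \<le> R1" using R[OF \<open>p \<in> P\<close> that] by (auto simp: R1_def)
      then have "\<bar>c j p\<bar> * N \<le> R1 * N" by (intro mult_right_mono) auto
      then have "\<bar>c j p * N / R1\<bar> \<le> N" using R1 by (simp add: abs_mult field_simps)
      then have "- real N \<le> c j p * N / R1" "c j p * N / R1 < real N + 1" by linarith+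
      then show ?thesis by (simp add: le_floor_iff floor_le_iff)
    qed
    then show ?thesis by (auto simp: idx_def K_def)
  qed
  have "finite K" using J(1) by (auto simp: K_def intro: finite_PiE)
  moreover have "F ` P \<subseteq> (\<Union>k\<in>K. C k)" using idx by (auto simp: C_def)
  moreover have "\<forall>k\<in>K. \<forall>x\<in>C k. \<forall>y\<in>C k. dist x y \<le> D"
  proof (intro ballI)
    fix k x y assume "x \<in> C k" "y \<in> C k"
    then obtain p q where pq: "p \<in> P" "q \<in> P" "x = F p" "y = F q" "idx p = idx q" by (auto simp: C_def)
    have "\<bar>c j p - c j q\<bar> \<le> R1 / N" if "j \<in> J" for j
    proof -
      have "\<lfloor>c j p * N / R1\<rfloor> = \<lfloor>c j q * N / R1\<rfloor>" using fun_cong[OF pq(5), of j] that by (simp add: idx_def)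
      then have "\<bar>c j p * N / R1 - c j q * N / R1\<bar> \<le> 1" by linarith
      moreover have "c j p * N / R1 - c j q * N / R1 = (c j p - c j q) * (N / R1)"
        by (simp add: left_diff_distrib diff_divide_distrib)
      ultimately have "\<bar>(c j p - c j q) * (N / R1)\<bar> \<le> 1" by (simp only:)
      then have "\<bar>c j p - c j q\<bar> * (N / R1) \<le> 1" using R1(1) by (simp only: abs_mult) simp
      then show ?thesis using R1(1) N by (simp add: field_simps)
    qed
    then have "(\<Sum>j\<in>J. \<bar>c j p - c j q\<bar>) \<le> d * (R1 / N)"
      unfolding d_def by (rule sum_bounded_above)
    then have "\<bar>L\<bar> * (\<Sum>j\<in>J. \<bar>c j p - c j q\<bar>) \<le> \<bar>L\<bar> * (d * (R1 / N))"
      by (rule mult_left_mono) simp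
    moreover have "L * (\<Sum>j\<in>J. \<bar>c j p - c j q\<bar>) \<le> \<bar>L\<bar> * (\<Sum>j\<in>J. \<bar>c j p - c j q\<bar>)"
      by (intro mult_right_mono sum_nonneg) auto
    ultimately show "dist x y \<le> D" using L[OF pq(1,2)] pq(3,4) by (simp add: D_def A_def)
  qed
  moreover have "0 \<le> D" "D \<le> \<epsilon>" using R1 N'(2) by (auto simp: D_def N_def)
  moreover have "real (card K) * D powr s \<le> \<epsilon>"
  proof -
    have "card K = (2 * N + 1) ^ d" using J(1) by (simp add: K_def card_PiE d_def) (simp add: nat_add_distrib nat_mult_distrib)
    also have "\<dots> \<le> (3 * N) ^ d" using N by (intro power_mono) auto
    finally have "real (card K) \<le> 3 ^ d * real N ^ d" by (metis of_nat_le_iff of_nat_power power_mult_distrib of_nat_mult of_nat_numeral)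
    then have "real (card K) * D powr s \<le> (3 ^ d * real N ^ d) * D powr s"
      by (rule mult_right_mono) simp
    also have "\<dots> = (3 ^ d * A powr s) * (real N powr real d / real N powr s)"
      using N R1(2) by (simp add: D_def powr_divide powr_realpow)
    also have "real N powr real d / real N powr s = real N powr (real d - s)" by (simp add: powr_diff)
    finally show ?thesis using N'(1) by (simp add: N_def)
  qed
  ultimately show "\<exists>(K :: ('j \<Rightarrow> int) set) C D. finite K \<and> F ` P \<subseteq> (\<Union>k\<in>K. C k) \<and> (\<forall>k\<in>K. \<forall>x\<in>C k. \<forall>y\<in>C k. dist x y \<le> D) \<and>
      0 \<le> D \<and> D \<le> \<epsilon> \<and> real (card K) * D powr s \<le> \<epsilon>"
    by (intro exI[of _ K] exI[of _ C] exI[of _ D] conjI)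
qed

section \<open>Matrices incident to a parametrized family of vectors\<close>

lemma norm_matrix_le_sum_abs:
  fixes M :: "real ^ 'm ^ 'l"
  shows "norm M \<le> (\<Sum>i\<in>UNIV. \<Sum>j\<in>UNIV. \<bar>M $ i $ j\<bar>)"
proof -
  have "norm M \<le> (\<Sum>i\<in>UNIV. norm (M $ i))"
    unfolding norm_vec_def by (rule L2_set_le_sum) auto
  also have "\<dots> \<le> (\<Sum>i\<in>UNIV. \<Sum>j\<in>UNIV. \<bar>M $ i $ j\<bar>)"
    by (intro sum_mono norm_le_l1_cart)
  finally show ?thesis .
qed

lemma matrix_entry_le_norm:
  fixes M :: "real ^ 'm ^ 'l"
  shows "\<bar>M $ i $ j\<bar> \<le> norm M"
  using component_le_norm_cart[of "M $ i" j] Finite_Cartesian_Product.norm_nth_le[of M i] by linarith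

text \<open>
  In row \<open>i\<close>, the equation \<open>M a = b\<close> determines \<open>M\<^sub>i\<^sub>k a\<^sub>k\<close> from \<open>b\<^sub>i\<close>, the other coordinates of \<open>a\<close> and
  the other entries of the row. Subtracting the two instances of this equation and dividing by
  \<open>a\<^sub>k\<close>, which is at least \<open>\<eta>\<close> in absolute value, bounds the difference of the \<open>k\<close>-th columns by
  the bound \<open>S\<close> on the difference of the data and the differences of the remaining entries.
\<close>

lemma incidence_Lipschitz:
  fixes M M' :: "real ^ 'm ^ 'l" and a a' :: "real ^ 'm" and b b' :: "real ^ 'l"
  assumes eq: "M *v a = b" "M' *v a' = b'"
    and k: "\<eta> \<le> \<bar>a $ k\<bar>" "\<eta> > 0" and R: "norm a \<le> R" "norm M' \<le> R"
    and S: "norm (a - a') \<le> S" "norm (b - b') \<le> S"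
  shows "norm (M - M') \<le> (1 + real CARD('l) * (1 + R + real CARD('m) * R) / \<eta>) *
     (S + (\<Sum>(i, j)\<in>UNIV \<times> (UNIV - {k}). \<bar>M $ i $ j - M' $ i $ j\<bar>))"
proof -
  define T where "T = (\<Sum>(i, j)\<in>UNIV \<times> (UNIV - {k}). \<bar>M $ i $ j - M' $ i $ j\<bar>)"
  define K where "K = 1 + R + real CARD('m) * R"
  have S0: "S \<ge> 0" using S(1) norm_ge_zero order_trans by blast
  have R0: "R \<ge> 0" using R(1) norm_ge_zero order_trans by blast
  have T0: "T \<ge> 0" unfolding T_def by (rule sum_nonneg) auto
  have T_split: "T = (\<Sum>i\<in>UNIV. \<Sum>j\<in>UNIV - {k}. \<bar>M $ i $ j - M' $ i $ j\<bar>)"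
    unfolding T_def by (simp add: sum.cartesian_product)
  have row_T: "(\<Sum>j\<in>UNIV - {k}. \<bar>M $ i $ j - M' $ i $ j\<bar>) \<le> T" for i
    unfolding T_split by (rule member_le_sum) (auto intro: sum_nonneg)
  have col: "\<bar>M $ i $ k - M' $ i $ k\<bar> \<le> K / \<eta> * (S + T)" for i
  proof -
    have 1: "(\<Sum>j\<in>UNIV. M $ i $ j * a $ j) = b $ i" "(\<Sum>j\<in>UNIV. M' $ i $ j * a' $ j) = b' $ i"
      using eq by (auto simp: matrix_vector_mult_def vec_eq_iff)
    have "(\<Sum>j\<in>UNIV. (M $ i $ j - M' $ i $ j) * a $ j)
        = (\<Sum>j\<in>UNIV. M $ i $ j * a $ j) - (\<Sum>j\<in>UNIV. M' $ i $ j * a' $ j)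
          - (\<Sum>j\<in>UNIV. M' $ i $ j * (a $ j - a' $ j))"
      by (simp add: sum_subtractf[symmetric] algebra_simps)
    moreover have "(\<Sum>j\<in>UNIV. (M $ i $ j - M' $ i $ j) * a $ j)
        = (M $ i $ k - M' $ i $ k) * a $ k + (\<Sum>j\<in>UNIV - {k}. (M $ i $ j - M' $ i $ j) * a $ j)"
      by (rule sum.remove) auto
    ultimately have eq2: "(M $ i $ k - M' $ i $ k) * a $ k = (b - b') $ i
        - (\<Sum>j\<in>UNIV. M' $ i $ j * (a $ j - a' $ j))
        - (\<Sum>j\<in>UNIV - {k}. (M $ i $ j - M' $ i $ j) * a $ j)"
      using 1 by simp
    have "\<bar>(b - b') $ i\<bar> \<le> S" using component_le_norm_cart[of "b - b'" i] S(2) by linarith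
    moreover have "\<bar>\<Sum>j\<in>UNIV. M' $ i $ j * (a $ j - a' $ j)\<bar> \<le> (\<Sum>j\<in>(UNIV::'m set). R * S)"
    proof (rule order_trans[OF sum_abs], rule sum_mono)
      fix j :: 'm
      have "\<bar>M' $ i $ j\<bar> \<le> R" using matrix_entry_le_norm[of M' i j] R(2) by linarith
      moreover have "\<bar>a $ j - a' $ j\<bar> \<le> S" using component_le_norm_cart[of "a - a'" j] S(1) by simp
      ultimately show "\<bar>M' $ i $ j * (a $ j - a' $ j)\<bar> \<le> R * S"
        unfolding abs_mult using R0 by (intro mult_mono) auto
    qed
    moreover have "\<bar>\<Sum>j\<in>UNIV - {k}. (M $ i $ j - M' $ i $ j) * a $ j\<bar> \<le> R * T"
    proof -
      have "\<bar>\<Sum>j\<in>UNIV - {k}. (M $ i $ j - M' $ i $ j) * a $ j\<bar>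
          \<le> (\<Sum>j\<in>UNIV - {k}. \<bar>M $ i $ j - M' $ i $ j\<bar> * R)"
      proof (rule order_trans[OF sum_abs], rule sum_mono)
        fix j :: 'm
        have "\<bar>a $ j\<bar> \<le> R" using component_le_norm_cart[of a j] R(1) by simp
        then show "\<bar>(M $ i $ j - M' $ i $ j) * a $ j\<bar> \<le> \<bar>M $ i $ j - M' $ i $ j\<bar> * R"
          unfolding abs_mult by (intro mult_left_mono) auto
      qed
      also have "\<dots> = R * (\<Sum>j\<in>UNIV - {k}. \<bar>M $ i $ j - M' $ i $ j\<bar>)"
        by (simp add: sum_distrib_left mult.commute)
      also have "\<dots> \<le> R * T" using row_T R0 by (intro mult_left_mono) auto
      finally show ?thesis .
    qed
    ultimately have "\<bar>(M $ i $ k - M' $ i $ k) * a $ k\<bar> \<le> S + real CARD('m) * (R * S) + R * T"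
      unfolding eq2 by simp
    also have "\<dots> \<le> K * (S + T)"
      unfolding K_def using S0 R0 T0 by (simp add: algebra_simps)
    finally have "\<bar>M $ i $ k - M' $ i $ k\<bar> * \<bar>a $ k\<bar> \<le> K * (S + T)" by (simp add: abs_mult)
    moreover have "\<bar>M $ i $ k - M' $ i $ k\<bar> * \<eta> \<le> \<bar>M $ i $ k - M' $ i $ k\<bar> * \<bar>a $ k\<bar>"
      using k by (intro mult_left_mono) auto
    ultimately have "\<bar>M $ i $ k - M' $ i $ k\<bar> * \<eta> \<le> K * (S + T)" by linarith
    then show ?thesis using k(2) by (simp add: field_simps)
  qed
  have "norm (M - M') \<le> (\<Sum>i\<in>UNIV. \<Sum>j\<in>UNIV. \<bar>M $ i $ j - M' $ i $ j\<bar>)"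
    using norm_matrix_le_sum_abs[of "M - M'"] by simp
  also have "\<dots> = (\<Sum>i\<in>UNIV. \<bar>M $ i $ k - M' $ i $ k\<bar> + (\<Sum>j\<in>UNIV - {k}. \<bar>M $ i $ j - M' $ i $ j\<bar>))"
    by (intro sum.cong refl sum.remove) auto
  also have "\<dots> = (\<Sum>i\<in>UNIV. \<bar>M $ i $ k - M' $ i $ k\<bar>) + T"
    unfolding T_split by (rule sum.distrib)
  also have "\<dots> \<le> (\<Sum>i\<in>(UNIV::'l set). K / \<eta> * (S + T)) + T"
    using col by (intro add_mono sum_mono) auto
  also have "\<dots> \<le> (1 + real CARD('l) * K / \<eta>) * (S + T)"
    using S0 by (simp add: algebra_simps)
  finally show ?thesis by (simp add: K_def T_def)
qed

text \<open>
  The coordinates of an incident pair \<open>(q, M)\<close> are those of \<open>q\<close> together with the entries of \<open>M\<close>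
  outside column \<open>k\<close>; by \<open>incidence_Lipschitz\<close> they control \<open>M\<close>.
\<close>

lemma incidence_null_bounded:
  fixes a :: "'q \<Rightarrow> real ^ 'm" and b :: "'q \<Rightarrow> real ^ 'l" and c :: "'j \<Rightarrow> 'q \<Rightarrow> real"
  assumes J: "finite J" "real (card J) + (real CARD('m) - 1) * real CARD('l) < s"
    and lip: "\<And>q q'. q \<in> Q \<Longrightarrow> q' \<in> Q \<Longrightarrow> norm (a q - a q') \<le> L * (\<Sum>j\<in>J. \<bar>c j q - c j q'\<bar>)"
      "\<And>q q'. q \<in> Q \<Longrightarrow> q' \<in> Q \<Longrightarrow> norm (b q - b q') \<le> L * (\<Sum>j\<in>J. \<bar>c j q - c j q'\<bar>)"
    and bd: "\<And>q. q \<in> Q \<Longrightarrow> \<eta> \<le> \<bar>a q $ k\<bar>" "\<eta> > 0" "\<And>q. q \<in> Q \<Longrightarrow> norm (a q) \<le> R"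
      "\<And>q j. q \<in> Q \<Longrightarrow> j \<in> J \<Longrightarrow> \<bar>c j q\<bar> \<le> R"
  shows "hausdorff_null s {M :: real ^ 'm ^ 'l. norm M \<le> R \<and> (\<exists>q\<in>Q. M *v a q = b q)}"
proof -
  define E where "E = (UNIV :: 'l set) \<times> (UNIV - {k})"
  define P where "P = {(q, M :: real ^ 'm ^ 'l). q \<in> Q \<and> norm M \<le> R \<and> M *v a q = b q}"
  define d where "d = case_sum (\<lambda>j (q, M :: real ^ 'm ^ 'l). c j q) (\<lambda>(i, j) (q, M). M $ i $ j)"
  define L' where "L' = max L 1"
  define K where "K = (1 + real CARD('l) * (1 + R + real CARD('m) * R) / \<eta>)"
  have "hausdorff_null s (snd ` P)"
  proof (rule hausdorff_null_Lipschitz_image[where c = d and J = "J <+> E" and R = R and L = "K * L'"])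
    show "finite (J <+> E)" using J(1) by (simp add: E_def)
    have "card E = CARD('l) * (CARD('m) - 1)"
      by (simp add: E_def card_cartesian_product card_Diff_subset)
    moreover have "CARD('m) \<ge> 1" by (simp add: Suc_leI)
    ultimately have "real (card E) = (real CARD('m) - 1) * real CARD('l)" by (simp add: of_nat_diff mult.commute)
    moreover have "card (J <+> E) = card J + card E" using J(1) by (intro card_Plus) (auto simp: E_def)
    ultimately show "real (card (J <+> E)) < s" using J(2) by simp
    show "\<bar>d z p\<bar> \<le> R" if p: "p \<in> P" and z: "z \<in> J <+> E" for p z
    proof -
      obtain q M where qM: "p = (q, M)" "q \<in> Q" "norm M \<le> R" using p by (auto simp: P_def)
      then have "\<bar>M $ i $ j\<bar> \<le> R" for i j using matrix_entry_le_norm[of M i j] by linarith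
      then show ?thesis using z bd(4) qM by (auto simp: d_def)
    qed
    fix p p' assume "p \<in> P" "p' \<in> P"
    then obtain q M q' M' where p: "p = (q, M)" "q \<in> Q" "norm M \<le> R" "M *v a q = b q"
      "p' = (q', M')" "q' \<in> Q" "norm M' \<le> R" "M' *v a q' = b q'" by (auto simp: P_def)
    define S where "S = (\<Sum>j\<in>J. \<bar>c j q - c j q'\<bar>)"
    define T where "T = (\<Sum>(i, j)\<in>E. \<bar>M $ i $ j - M' $ i $ j\<bar>)"
    have S0: "S \<ge> 0" unfolding S_def by (rule sum_nonneg) auto
    have T0: "T \<ge> 0" unfolding T_def by (rule sum_nonneg) auto
    have R0: "R \<ge> 0" using p(3) norm_ge_zero order_trans by blast
    have "L * S \<le> L' * S" using S0 by (intro mult_right_mono) (auto simp: L'_def)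
    then have "norm (a q - a q') \<le> L' * S" "norm (b q - b q') \<le> L' * S"
      using lip[OF p(2,6)] by (auto simp: S_def)
    from incidence_Lipschitz[OF p(4,8) bd(1)[OF p(2)] bd(2) bd(3)[OF p(2)] p(7) this]
    have "norm (M - M') \<le> K * (L' * S + T)" unfolding K_def T_def E_def .
    also have "\<dots> \<le> K * (L' * (S + T))"
    proof (rule mult_left_mono)
      show "L' * S + T \<le> L' * (S + T)"
        using T0 mult_right_mono[of 1 L' T] by (simp add: L'_def distrib_left)
      show "K \<ge> 0" using R0 bd(2) by (auto simp: K_def)
    qed
    also have "S + T = (\<Sum>z\<in>J <+> E. \<bar>d z p - d z p'\<bar>)"
      using J(1) by (subst sum.Plus) (auto simp: S_def T_def E_def d_def p case_prod_unfold)
    finally show "dist (snd p) (snd p') \<le> K * L' * (\<Sum>z\<in>J <+> E. \<bar>d z p - d z p'\<bar>)"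
      by (simp add: p dist_norm mult.assoc)
  qed
  moreover have "{M :: real ^ 'm ^ 'l. norm M \<le> R \<and> (\<exists>q\<in>Q. M *v a q = b q)} \<subseteq> snd ` P"
    by (force simp: P_def)
  ultimately show ?thesis by (rule hausdorff_null_subset)
qed

text \<open>
  Distances between parameters are measured by finitely many real coordinates \<open>c\<close> instead of a
  metric. The bound on \<open>F\<close> itself is part of the notion to make it stable under products, and using
  the same constant \<open>L\<close> for it entails \<open>L \<ge> 0\<close>.
\<close>

definition locally_Lipschitz_wrt ::
  "'j set \<Rightarrow> ('j \<Rightarrow> 'q \<Rightarrow> real) \<Rightarrow> 'q::topological_space set \<Rightarrow> ('q \<Rightarrow> 'b::real_normed_vector) \<Rightarrow> bool" where
  "locally_Lipschitz_wrt J c Q F \<longleftrightarrow> (\<forall>q\<in>Q. \<exists>W L. open W \<and> q \<in> W \<and>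
     (\<forall>x\<in>Q \<inter> W. norm (F x) \<le> L) \<and>
     (\<forall>x\<in>Q \<inter> W. \<forall>y\<in>Q \<inter> W. norm (F x - F y) \<le> L * (\<Sum>j\<in>J. \<bar>c j x - c j y\<bar>)))"

lemma locally_Lipschitz_wrtE:
  assumes "locally_Lipschitz_wrt J c Q F" "q \<in> Q"
  obtains W L where "open W" "q \<in> W" "L \<ge> 0" "\<And>x. x \<in> Q \<inter> W \<Longrightarrow> norm (F x) \<le> L"
    "\<And>x y. x \<in> Q \<inter> W \<Longrightarrow> y \<in> Q \<inter> W \<Longrightarrow> norm (F x - F y) \<le> L * (\<Sum>j\<in>J. \<bar>c j x - c j y\<bar>)"
proof -
  obtain W L where W: "open W" "q \<in> W" "\<forall>x\<in>Q \<inter> W. norm (F x) \<le> L"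
    "\<forall>x\<in>Q \<inter> W. \<forall>y\<in>Q \<inter> W. norm (F x - F y) \<le> L * (\<Sum>j\<in>J. \<bar>c j x - c j y\<bar>)"
    using assms unfolding locally_Lipschitz_wrt_def by meson
  have "norm (F q) \<le> L" using W(2,3) assms(2) by simp
  then have "L \<ge> 0" using norm_ge_zero[of "F q"] by linarith
  then show ?thesis using that[OF W(1,2)] W(3,4) by simp
qed

lemma locally_Lipschitz_wrt_diff:
  assumes "locally_Lipschitz_wrt J c Q F" "locally_Lipschitz_wrt J c Q G"
  shows "locally_Lipschitz_wrt J c Q (\<lambda>x. F x - G x)"
  unfolding locally_Lipschitz_wrt_def
proof
  fix q assume q: "q \<in> Q"
  obtain W L where W: "open W" "q \<in> W" "L \<ge> 0" "\<And>x. x \<in> Q \<inter> W \<Longrightarrow> norm (F x) \<le> L"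
    "\<And>x y. x \<in> Q \<inter> W \<Longrightarrow> y \<in> Q \<inter> W \<Longrightarrow> norm (F x - F y) \<le> L * (\<Sum>j\<in>J. \<bar>c j x - c j y\<bar>)"
    by (rule locally_Lipschitz_wrtE[OF assms(1) q], rule that) blast+
  obtain W' L' where W': "open W'" "q \<in> W'" "L' \<ge> 0" "\<And>x. x \<in> Q \<inter> W' \<Longrightarrow> norm (G x) \<le> L'"
    "\<And>x y. x \<in> Q \<inter> W' \<Longrightarrow> y \<in> Q \<inter> W' \<Longrightarrow> norm (G x - G y) \<le> L' * (\<Sum>j\<in>J. \<bar>c j x - c j y\<bar>)"
    by (rule locally_Lipschitz_wrtE[OF assms(2) q], rule that) blast+
  have "norm (F x - G x) \<le> L + L'" if "x \<in> Q \<inter> (W \<inter> W')" for x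
    using W(4)[of x] W'(4)[of x] that norm_triangle_ineq4[of "F x" "G x"] by auto
  moreover have "norm ((F x - G x) - (F y - G y)) \<le> (L + L') * (\<Sum>j\<in>J. \<bar>c j x - c j y\<bar>)"
    if "x \<in> Q \<inter> (W \<inter> W')" "y \<in> Q \<inter> (W \<inter> W')" for x y
  proof -
    have eq: "(F x - G x) - (F y - G y) = (F x - F y) - (G x - G y)" by simp
    have "norm (F x - F y) \<le> L * (\<Sum>j\<in>J. \<bar>c j x - c j y\<bar>)"
      "norm (G x - G y) \<le> L' * (\<Sum>j\<in>J. \<bar>c j x - c j y\<bar>)"
      using W(5) W'(5) that by blast+
    then show ?thesis
      unfolding eq distrib_right using norm_triangle_ineq4[of "F x - F y" "G x - G y"] by linarith
  qed
  ultimately show "\<exists>W L. open W \<and> q \<in> W \<and> (\<forall>x\<in>Q \<inter> W. norm (F x - G x) \<le> L) \<and>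
     (\<forall>x\<in>Q \<inter> W. \<forall>y\<in>Q \<inter> W. norm ((F x - G x) - (F y - G y)) \<le> L * (\<Sum>j\<in>J. \<bar>c j x - c j y\<bar>))"
    using W(1,2) W'(1,2) by (intro exI[of _ "W \<inter> W'"] exI[of _ "L + L'"]) auto
qed

lemma locally_Lipschitz_wrt_scaleR:
  assumes "locally_Lipschitz_wrt J c Q a" "locally_Lipschitz_wrt J c Q F"
  shows "locally_Lipschitz_wrt J c Q (\<lambda>x. a x *\<^sub>R F x)"
  unfolding locally_Lipschitz_wrt_def
proof
  fix q assume q: "q \<in> Q"
  obtain W L where W: "open W" "q \<in> W" "L \<ge> 0" "\<And>x. x \<in> Q \<inter> W \<Longrightarrow> norm (a x) \<le> L"
    "\<And>x y. x \<in> Q \<inter> W \<Longrightarrow> y \<in> Q \<inter> W \<Longrightarrow> norm (a x - a y) \<le> L * (\<Sum>j\<in>J. \<bar>c j x - c j y\<bar>)"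
    by (rule locally_Lipschitz_wrtE[OF assms(1) q], rule that) blast+
  obtain W' L' where W': "open W'" "q \<in> W'" "L' \<ge> 0" "\<And>x. x \<in> Q \<inter> W' \<Longrightarrow> norm (F x) \<le> L'"
    "\<And>x y. x \<in> Q \<inter> W' \<Longrightarrow> y \<in> Q \<inter> W' \<Longrightarrow> norm (F x - F y) \<le> L' * (\<Sum>j\<in>J. \<bar>c j x - c j y\<bar>)"
    by (rule locally_Lipschitz_wrtE[OF assms(2) q], rule that) blast+
  have LL: "0 \<le> L * L'" using W(3) W'(3) by simp
  have "norm (a x *\<^sub>R F x) \<le> 2 * L * L'" if "x \<in> Q \<inter> (W \<inter> W')" for x
  proof -
    have "norm (a x) * norm (F x) \<le> L * L'"
      using W(3) W(4)[of x] W'(4)[of x] that by (intro mult_mono) auto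
    then show ?thesis using LL by simp
  qed
  moreover have "norm (a x *\<^sub>R F x - a y *\<^sub>R F y) \<le> 2 * L * L' * (\<Sum>j\<in>J. \<bar>c j x - c j y\<bar>)"
    if xy: "x \<in> Q \<inter> (W \<inter> W')" "y \<in> Q \<inter> (W \<inter> W')" for x y
  proof -
    define S where "S = (\<Sum>j\<in>J. \<bar>c j x - c j y\<bar>)"
    have S: "S \<ge> 0" unfolding S_def by (rule sum_nonneg) auto
    have "a x *\<^sub>R F x - a y *\<^sub>R F y = (a x - a y) *\<^sub>R F x + a y *\<^sub>R (F x - F y)"
      by (simp add: algebra_simps)
    moreover have "norm ((a x - a y) *\<^sub>R F x) \<le> (L * S) * L'"
      unfolding norm_scaleR real_norm_def[symmetric] S_def
      using W(3) W(5)[of x y] W'(4)[of x] xy by (intro mult_mono) (auto intro: sum_nonneg)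
    moreover have "norm (a y *\<^sub>R (F x - F y)) \<le> L * (L' * S)"
      unfolding norm_scaleR real_norm_def[symmetric] S_def
      using W(3) W(4)[of y] W'(5)[of x y] xy by (intro mult_mono) auto
    ultimately have "norm (a x *\<^sub>R F x - a y *\<^sub>R F y) \<le> (L * S) * L' + L * (L' * S)"
      by (metis norm_triangle_mono)
    then show ?thesis by (simp add: S_def algebra_simps)
  qed
  ultimately show "\<exists>W L. open W \<and> q \<in> W \<and> (\<forall>x\<in>Q \<inter> W. norm (a x *\<^sub>R F x) \<le> L) \<and>
     (\<forall>x\<in>Q \<inter> W. \<forall>y\<in>Q \<inter> W. norm (a x *\<^sub>R F x - a y *\<^sub>R F y) \<le> L * (\<Sum>j\<in>J. \<bar>c j x - c j y\<bar>))"
    using W(1,2) W'(1,2) by (intro exI[of _ "W \<inter> W'"] exI[of _ "2 * L * L'"]) auto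
qed

lemma locally_Lipschitz_wrt_zero: "locally_Lipschitz_wrt J c Q (\<lambda>x. 0)"
  unfolding locally_Lipschitz_wrt_def by (intro ballI exI[of _ UNIV] exI[of _ 0]) auto

lemma locally_Lipschitz_wrt_sum:
  assumes "finite K" "\<And>k. k \<in> K \<Longrightarrow> locally_Lipschitz_wrt J c Q (F k)"
  shows "locally_Lipschitz_wrt J c Q (\<lambda>x. \<Sum>k\<in>K. F k x)"
  using assms
proof (induction K)
  case (insert k K)
  \<comment> \<open>Addition is obtained as subtraction of a negative.\<close>
  have neg: "locally_Lipschitz_wrt J c Q (\<lambda>x. 0 - (\<Sum>k\<in>K. F k x))"
    using insert by (intro locally_Lipschitz_wrt_diff locally_Lipschitz_wrt_zero) auto
  have "locally_Lipschitz_wrt J c Q (\<lambda>x. F k x - (0 - (\<Sum>k\<in>K. F k x)))"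
    using insert.prems by (intro locally_Lipschitz_wrt_diff neg) auto
  then show ?case using insert.hyps by simp
qed (simp add: locally_Lipschitz_wrt_zero)

lemma locally_Lipschitz_wrt_coord:
  fixes c :: "'j \<Rightarrow> 'q::topological_space \<Rightarrow> real"
  assumes "finite J" "j \<in> J" "continuous_on UNIV (c j)"
  shows "locally_Lipschitz_wrt J c Q (c j)"
  unfolding locally_Lipschitz_wrt_def
proof
  fix q assume "q \<in> Q"
  define W where "W = {x. \<bar>c j x - c j q\<bar> < 1}"
  have "open W" unfolding W_def using assms(3) by (intro open_Collect_less continuous_intros)
  moreover have "\<bar>c j x\<bar> \<le> 1 + \<bar>c j q\<bar>" if "x \<in> W" for x using that by (auto simp: W_def)
  moreover have "\<bar>c j x - c j y\<bar> \<le> (1 + \<bar>c j q\<bar>) * (\<Sum>j\<in>J. \<bar>c j x - c j y\<bar>)" for x y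
  proof -
    have "\<bar>c j x - c j y\<bar> \<le> (\<Sum>j\<in>J. \<bar>c j x - c j y\<bar>)"
      using assms by (intro member_le_sum) auto
    also have "\<dots> = 1 * (\<Sum>j\<in>J. \<bar>c j x - c j y\<bar>)" by simp
    also have "\<dots> \<le> (1 + \<bar>c j q\<bar>) * (\<Sum>j\<in>J. \<bar>c j x - c j y\<bar>)"
      by (intro mult_right_mono sum_nonneg) auto
    finally show ?thesis .
  qed
  ultimately show "\<exists>W L. open W \<and> q \<in> W \<and> (\<forall>x\<in>Q \<inter> W. norm (c j x) \<le> L) \<and>
     (\<forall>x\<in>Q \<inter> W. \<forall>y\<in>Q \<inter> W. norm (c j x - c j y) \<le> L * (\<Sum>j\<in>J. \<bar>c j x - c j y\<bar>))"
    by (intro exI[of _ W] exI[of _ "1 + \<bar>c j q\<bar>"]) (auto simp: W_def)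
qed

lemma locally_Lipschitz_wrt_pullback:
  fixes h :: "'q::topological_space \<Rightarrow> 'p::topological_space"
  assumes F: "locally_Lipschitz_wrt I d U F" and h: "continuous_on UNIV h" "h ` Q \<subseteq> U"
    and le: "\<And>x y. (\<Sum>i\<in>I. \<bar>d i (h x) - d i (h y)\<bar>) \<le> (\<Sum>j\<in>J. \<bar>c j x - c j y\<bar>)"
  shows "locally_Lipschitz_wrt J c Q (\<lambda>x. F (h x))"
  unfolding locally_Lipschitz_wrt_def
proof
  fix q assume q: "q \<in> Q"
  then have "h q \<in> U" using h by auto
  obtain W L where W: "open W" "h q \<in> W" "L \<ge> 0" "\<And>x. x \<in> U \<inter> W \<Longrightarrow> norm (F x) \<le> L"
    "\<And>x y. x \<in> U \<inter> W \<Longrightarrow> y \<in> U \<inter> W \<Longrightarrow> norm (F x - F y) \<le> L * (\<Sum>j\<in>I. \<bar>d j x - d j y\<bar>)"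
    by (rule locally_Lipschitz_wrtE[OF F \<open>h q \<in> U\<close>], rule that) blast+
  have "open (h -` W)" using W(1) h(1) by (rule open_vimage)
  moreover have "norm (F (h x) - F (h y)) \<le> L * (\<Sum>j\<in>J. \<bar>c j x - c j y\<bar>)"
    if "x \<in> Q \<inter> h -` W" "y \<in> Q \<inter> h -` W" for x y
  proof -
    have "h x \<in> U \<inter> W" "h y \<in> U \<inter> W" using that h(2) by auto
    from W(5)[OF this] mult_left_mono[OF le W(3), of x y] show ?thesis by linarith
  qed
  moreover have "norm (F (h x)) \<le> L" if "x \<in> Q \<inter> h -` W" for x
    using W(4)[of "h x"] that h(2) by auto
  ultimately show "\<exists>W L. open W \<and> q \<in> W \<and> (\<forall>x\<in>Q \<inter> W. norm (F (h x)) \<le> L) \<and>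
     (\<forall>x\<in>Q \<inter> W. \<forall>y\<in>Q \<inter> W. norm (F (h x) - F (h y)) \<le> L * (\<Sum>j\<in>J. \<bar>c j x - c j y\<bar>))"
    using W(2) by (intro exI[of _ "h -` W"] exI[of _ L]) auto
qed

text \<open>
  The parameters are cut into countably many pieces to which \<open>incidence_null_bounded\<close> applies: a
  Lindelof subcover deals with the locality of the Lipschitz bounds, the index \<open>k\<close> selects a nonzero
  coordinate of \<open>a\<close>, and the natural number \<open>R\<close> bounds all quantities involved from above and
  \<open>\<bar>a\<^sub>k\<bar>\<close> from below by \<open>1 / (R + 1)\<close>.
\<close>

lemma incidence_null:
  fixes a :: "'q::second_countable_topology \<Rightarrow> real ^ 'm" and b :: "'q \<Rightarrow> real ^ 'l"
    and c :: "'j \<Rightarrow> 'q \<Rightarrow> real"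
  assumes J: "finite J" "real (card J) + (real CARD('m) - 1) * real CARD('l) < s"
    and a: "locally_Lipschitz_wrt J c Q a" and b: "locally_Lipschitz_wrt J c Q b"
    and nz: "\<And>q. q \<in> Q \<Longrightarrow> a q \<noteq> 0"
  shows "hausdorff_null s {M :: real ^ 'm ^ 'l. \<exists>q\<in>Q. M *v a q = b q}"
proof -
  have lip: "\<exists>W L. open W \<and> q \<in> W \<and> (\<forall>x\<in>Q \<inter> W. \<forall>y\<in>Q \<inter> W.
        norm (a x - a y) \<le> L * (\<Sum>j\<in>J. \<bar>c j x - c j y\<bar>) \<and>
        norm (b x - b y) \<le> L * (\<Sum>j\<in>J. \<bar>c j x - c j y\<bar>))" if q: "q \<in> Q" for q
  proof -
    obtain W L where W: "open W" "q \<in> W" and "L \<ge> 0" "\<And>x. x \<in> Q \<inter> W \<Longrightarrow> norm (a x) \<le> L"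
      and WL: 
      "\<And>x y. x \<in> Q \<inter> W \<Longrightarrow> y \<in> Q \<inter> W \<Longrightarrow> norm (a x - a y) \<le> L * (\<Sum>j\<in>J. \<bar>c j x - c j y\<bar>)"
      by (rule locally_Lipschitz_wrtE[OF a q], rule that) blast+
    obtain W' L' where W': "open W'" "q \<in> W'" and "L' \<ge> 0" "\<And>x. x \<in> Q \<inter> W' \<Longrightarrow> norm (b x) \<le> L'"
      and WL':
      "\<And>x y. x \<in> Q \<inter> W' \<Longrightarrow> y \<in> Q \<inter> W' \<Longrightarrow> norm (b x - b y) \<le> L' * (\<Sum>j\<in>J. \<bar>c j x - c j y\<bar>)"
      by (rule locally_Lipschitz_wrtE[OF b q], rule that) blast+
    have *: "L * S \<le> max L L' * S \<and> L' * S \<le> max L L' * S" if "S \<ge> 0" for S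
      using that by (auto intro: mult_right_mono)
    have "norm (a x - a y) \<le> max L L' * (\<Sum>j\<in>J. \<bar>c j x - c j y\<bar>) \<and>
        norm (b x - b y) \<le> max L L' * (\<Sum>j\<in>J. \<bar>c j x - c j y\<bar>)"
      if "x \<in> Q \<inter> (W \<inter> W')" "y \<in> Q \<inter> (W \<inter> W')" for x y
      using WL[of x y] WL'[of x y] that *[of "\<Sum>j\<in>J. \<bar>c j x - c j y\<bar>"]
      by (force intro: sum_nonneg)
    then show ?thesis using W W'
      by (intro exI[of _ "W \<inter> W'"] exI[of _ "max L L'"]) blast
  qed
  define nbhd where "nbhd q W L \<longleftrightarrow> open W \<and> q \<in> W \<and> (\<forall>x\<in>Q \<inter> W. \<forall>y\<in>Q \<inter> W.
      norm (a x - a y) \<le> L * (\<Sum>j\<in>J. \<bar>c j x - c j y\<bar>) \<and>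
      norm (b x - b y) \<le> L * (\<Sum>j\<in>J. \<bar>c j x - c j y\<bar>))" for q W L
  have "\<exists>W L. nbhd q W L" if "q \<in> Q" for q
    using lip[OF that] unfolding nbhd_def .
  then obtain W L where nbhd: "\<And>q. q \<in> Q \<Longrightarrow> nbhd q (W q) (L q)" by metis
  have W: "open (W q)" "q \<in> W q" if "q \<in> Q" for q
    using nbhd[OF that] unfolding nbhd_def by auto
  have L: "norm (a x - a y) \<le> L q * (\<Sum>j\<in>J. \<bar>c j x - c j y\<bar>)"
    "norm (b x - b y) \<le> L q * (\<Sum>j\<in>J. \<bar>c j x - c j y\<bar>)"
    if "q \<in> Q" "x \<in> Q \<inter> W q" "y \<in> Q \<inter> W q" for q x y
    using nbhd[OF that(1)] that(2,3) unfolding nbhd_def by blast+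
  obtain F' where F': "F' \<subseteq> W ` Q" "countable F'" "\<Union>F' = \<Union>(W ` Q)"
  proof (rule Lindelof[of "W ` Q"])
    show "open S" if "S \<in> W ` Q" for S using that W(1) by auto
  qed
  then obtain Q0 where Q0: "Q0 \<subseteq> Q" "countable Q0" "F' = W ` Q0"
    using countable_subset_image[of F' W Q] by metis
  define piece where "piece q k R = {x \<in> Q \<inter> W q. 1 / real (Suc R) \<le> \<bar>a x $ k\<bar> \<and> norm (a x) \<le> real R \<and>
      (\<forall>j\<in>J. \<bar>c j x\<bar> \<le> real R)}" for q k R
  let ?B = "\<lambda>(q, k, R). {M :: real ^ 'm ^ 'l. norm M \<le> real R \<and> (\<exists>x\<in>piece q k R. M *v a x = b x)}"
  have "hausdorff_null s (\<Union>i\<in>Q0 \<times> (UNIV :: 'm set) \<times> (UNIV :: nat set). ?B i)"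
  proof (rule hausdorff_null_UN)
    show "countable (Q0 \<times> (UNIV :: 'm set) \<times> (UNIV :: nat set))"
      using Q0(2) by (intro countable_SIGMA) (auto intro: countable_finite)
    fix i assume "i \<in> Q0 \<times> (UNIV :: 'm set) \<times> (UNIV :: nat set)"
    then obtain q k R where i: "i = (q, k, R)" "q \<in> Q0" by auto
    then have "q \<in> Q" using Q0 by auto
    have "hausdorff_null s {M :: real ^ 'm ^ 'l. norm M \<le> real R \<and> (\<exists>x\<in>piece q k R. M *v a x = b x)}"
      by (rule incidence_null_bounded[OF J, where L = "L q" and \<eta> = "1 / real (Suc R)" and k = k and c = c])
         (use L[OF \<open>q \<in> Q\<close>] in \<open>auto simp: piece_def\<close>)
    then show "hausdorff_null s (?B i)" by (simp add: i)
  qed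
  moreover have "{M :: real ^ 'm ^ 'l. \<exists>q\<in>Q. M *v a q = b q} \<subseteq>
      (\<Union>i\<in>Q0 \<times> (UNIV :: 'm set) \<times> (UNIV :: nat set). ?B i)"
  proof
    fix M :: "real ^ 'm ^ 'l" assume "M \<in> {M. \<exists>q\<in>Q. M *v a q = b q}"
    then obtain x where x: "x \<in> Q" "M *v a x = b x" by auto
    then obtain q where q: "q \<in> Q0" "x \<in> W q" using F'(3) Q0(3) W(2)[of x] by blast
    obtain k where k: "a x $ k \<noteq> 0" using nz[OF x(1)] by (auto simp: vec_eq_iff)
    obtain R where R: "norm M + norm (a x) + 1 / \<bar>a x $ k\<bar> + (\<Sum>j\<in>J. \<bar>c j x\<bar>) \<le> real R"
      using real_arch_simple by blast
    have nn: "0 \<le> norm M" "0 \<le> norm (a x)" "0 < 1 / \<bar>a x $ k\<bar>" "0 \<le> (\<Sum>j\<in>J. \<bar>c j x\<bar>)"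
      using k by (auto intro: sum_nonneg)
    have "\<bar>c j x\<bar> \<le> real R" if "j \<in> J" for j
    proof -
      have "\<bar>c j x\<bar> \<le> (\<Sum>j\<in>J. \<bar>c j x\<bar>)" using that J(1) by (intro member_le_sum) auto
      then show ?thesis using nn R by linarith
    qed
    moreover have "1 / real (Suc R) \<le> \<bar>a x $ k\<bar>"
    proof -
      have "1 / \<bar>a x $ k\<bar> \<le> real (Suc R)" using R nn unfolding of_nat_Suc by linarith
      then show ?thesis using k by (simp add: field_simps)
    qed
    moreover have "norm M \<le> real R" "norm (a x) \<le> real R" using R nn by linarith+
    ultimately have "x \<in> piece q k R" "norm M \<le> real R" using x q by (auto simp: piece_def)
    then have "M \<in> ?B (q, k, R)" using x(2) by auto
    then show "M \<in> (\<Union>i\<in>Q0 \<times> (UNIV :: 'm set) \<times> (UNIV :: nat set). ?B i)" using q(1) by blast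
  qed
  ultimately show ?thesis by (rule hausdorff_null_subset)
qed

section \<open>Differential calculus with partial derivatives\<close>

text \<open>
  The type \<^typ>\<open>'i \<Rightarrow> real\<close> carries no norm, and only the coordinates in \<open>I\<close> are allowed to vary.
  Boxes of this kind take the place of balls, and \<open>coord_open\<close> is openness with respect to them.
\<close>

definition coord_box :: "'i set \<Rightarrow> ('i \<Rightarrow> real) \<Rightarrow> real \<Rightarrow> ('i \<Rightarrow> real) set" where
  "coord_box I p \<delta> = {y. (\<forall>i\<in>I. \<bar>y i - p i\<bar> < \<delta>) \<and> (\<forall>i. i \<notin> I \<longrightarrow> y i = p i)}"

definition coord_open :: "'i set \<Rightarrow> ('i \<Rightarrow> real) set \<Rightarrow> bool" where
  "coord_open I U \<longleftrightarrow> (\<forall>p\<in>U. \<exists>\<delta>>0. coord_box I p \<delta> \<subseteq> U)"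

lemma coord_box_self: "\<delta> > 0 \<Longrightarrow> p \<in> coord_box I p \<delta>"
  by (auto simp: coord_box_def)

lemma coord_box_mono: "\<delta> \<le> \<delta>' \<Longrightarrow> coord_box I p \<delta> \<subseteq> coord_box I p \<delta>'"
  by (auto simp: coord_box_def)

lemma coord_box_between:
  assumes "x \<in> coord_box I p \<delta>" "y \<in> coord_box I p \<delta>"
    and "\<And>i. z i \<in> closed_segment (x i) (y i)"
  shows "z \<in> coord_box I p \<delta>"
proof -
  have "\<bar>z i - p i\<bar> < \<delta>" if "i \<in> I" for i
    using assms(1,2) assms(3)[of i] that
    by (fastforce simp: coord_box_def closed_segment_eq_real_ivl abs_less_iff split: if_splits)
  moreover have "z i = p i" if "i \<notin> I" for i
    using assms(1,2) assms(3)[of i] that by (auto simp: coord_box_def)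
  ultimately show ?thesis by (auto simp: coord_box_def)
qed

lemma open_contains_coord_box:
  assumes "open W" "p \<in> W"
  shows "\<exists>\<delta>>0. coord_box I p \<delta> \<subseteq> W"
proof -
  have "openin (product_topology (\<lambda>i. euclidean) UNIV) W"
    using assms(1) by (metis euclidean_product_topology open_openin)
  from product_topology_open_contains_basis[OF this assms(2)] obtain X
    where X: "p \<in> (\<Pi>\<^sub>E i\<in>UNIV. X i)" "\<And>i. open (X i)" "finite {i. X i \<noteq> UNIV}"
      "(\<Pi>\<^sub>E i\<in>UNIV. X i) \<subseteq> W"
    by auto
  let ?F = "{i. X i \<noteq> UNIV}"
  have "\<exists>d>0. \<forall>t. \<bar>t - p i\<bar> < d \<longrightarrow> t \<in> X i" for i
    using X(1) X(2)[of i] unfolding open_dist PiE_iff dist_real_def by blast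
  then obtain d where d: "\<And>i. d i > 0" "\<And>i t. \<bar>t - p i\<bar> < d i \<Longrightarrow> t \<in> X i" by metis
  define \<delta> where "\<delta> = Min (insert 1 (d ` ?F))"
  have "\<delta> > 0" using X(3) d(1) by (auto simp: \<delta>_def)
  moreover have "coord_box I p \<delta> \<subseteq> W"
  proof
    fix y assume y: "y \<in> coord_box I p \<delta>"
    have "y i \<in> X i" for i
    proof (cases "X i = UNIV")
      case False
      then have "\<delta> \<le> d i" using X(3) by (auto simp: \<delta>_def)
      moreover have "\<bar>y i - p i\<bar> < \<delta>" using y \<open>\<delta> > 0\<close> by (cases "i \<in> I") (auto simp: coord_box_def)
      ultimately show ?thesis using d(2) by auto
    qed auto
    then show "y \<in> W" using X(4) by auto
  qed
  ultimately show ?thesis by blast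
qed

lemma open_coord_cube:
  fixes p :: "'i \<Rightarrow> real"
  assumes "finite I"
  shows "open {y. \<forall>i\<in>I. \<bar>y i - p i\<bar> < \<delta>}"
proof -
  have "{y. \<forall>i\<in>I. \<bar>y i - p i\<bar> < \<delta>} = (\<Inter>i\<in>I. {y. \<bar>y i - p i\<bar> < \<delta>})" by auto
  moreover have "open {y::'i \<Rightarrow> real. \<bar>y i - p i\<bar> < \<delta>}" for i
    by (intro open_Collect_less continuous_intros continuous_on_product_coordinates)
  ultimately show ?thesis using assms by auto
qed

lemma coord_open_Euclidean_space:
  assumes "openin (Euclidean_space n) U"
  shows "coord_open {..<n} U"
proof -
  obtain W where W': "openin (powertop_real UNIV) W" and W2: "U = W \<inter> {x. \<forall>i\<ge>n. x i = 0}"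
    using assms unfolding Euclidean_space_def openin_subtopology by blast
  have "open W" using W' by (metis euclidean_product_topology open_openin)
  note W = this W2
  show ?thesis unfolding coord_open_def
  proof
    fix p assume p: "p \<in> U"
    then obtain \<delta> where "\<delta> > 0" "coord_box {..<n} p \<delta> \<subseteq> W"
      using open_contains_coord_box[of W p] W by blast
    moreover have "coord_box {..<n} p \<delta> \<subseteq> {x. \<forall>i\<ge>n. x i = 0}"
      using p W(2) by (auto simp: coord_box_def)
    ultimately show "\<exists>\<delta>>0. coord_box {..<n} p \<delta> \<subseteq> U" using W(2) by blast
  qed
qed

text \<open>
  The coordinate map \<open>real ^ 'm \<Rightarrow> 'm \<Rightarrow> real\<close> is a homeomorphism, so the image of an open set is even open
  in the product topology.
\<close>

lemma coord_open_vec: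
  fixes V :: "(real ^ 'm) set"
  assumes "open V"
  shows "coord_open UNIV (vec_nth ` V)"
proof -
  have *: "vec_nth ` V = vec_lambda -` V"
    by (auto simp: image_iff) (metis vec_lambda_inverse UNIV_I)
  have "continuous_on UNIV (vec_lambda :: ('m \<Rightarrow> real) \<Rightarrow> _)"
    by (subst continuous_on_componentwise[where 'b = "real ^ 'm"])
       (auto simp: Basis_vec_def inner_axis intro: continuous_on_product_coordinates)
  then have "open (vec_nth ` V)" unfolding * using assms by (simp add: continuous_on_open_vimage)
  then show ?thesis unfolding coord_open_def using open_contains_coord_box by blast
qed

lemma eventually_coord_box:
  assumes "\<delta> > 0" "i \<in> I"
  shows "\<forall>\<^sub>F t in nhds (p i). p(i := t) \<in> coord_box I p \<delta>"
  unfolding eventually_nhds_metric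
  using assms by (intro exI[of _ \<delta>]) (auto simp: coord_box_def dist_real_def)

lemma eventually_coord_open:
  assumes "coord_open I U" "p \<in> U" "i \<in> I"
  shows "\<forall>\<^sub>F t in nhds (p i). p(i := t) \<in> U"
proof -
  obtain \<delta> where "\<delta> > 0" "coord_box I p \<delta> \<subseteq> U" using assms by (auto simp: coord_open_def)
  with eventually_coord_box[OF this(1) assms(3), of p] show ?thesis
    by (auto elim: eventually_mono)
qed

text \<open>
  One coordinate is moved from \<open>x i\<close> to \<open>y i\<close> at a time. Each move is controlled by the
  one-dimensional mean value inequality for \<open>F\<close> minus the linear map with slope \<open>d i\<close>, and all
  intermediate points stay in the box spanned by \<open>x\<close> and \<open>y\<close>.
\<close>

lemma mean_value_coordinatewise:
  fixes F :: "('i \<Rightarrow> real) \<Rightarrow> 'b::real_normed_vector"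
  assumes "finite I"
    and "\<And>i. i \<notin> I \<Longrightarrow> y i = x i"
    and "\<And>z i. i \<in> I \<Longrightarrow> (\<And>j. z j \<in> closed_segment (x j) (y j)) \<Longrightarrow>
           ((\<lambda>t. F (z(i := t))) has_vector_derivative D i z) (at (z i)) \<and> norm (D i z - d i) \<le> e"
  shows "norm (F y - F x - (\<Sum>i\<in>I. (y i - x i) *\<^sub>R d i)) \<le> e * (\<Sum>i\<in>I. \<bar>y i - x i\<bar>)"
  using assms
proof (induction I arbitrary: x rule: finite_induct)
  case empty
  then have "y = x" by auto
  then show ?case by simp
next
  case (insert i I)
  define x' where "x' = x(i := y i)"
  have x'I: "x' j = x j" if "j \<in> I" for j using insert.hyps that by (auto simp: x'_def)
  have "norm (F y - F x' - (\<Sum>j\<in>I. (y j - x' j) *\<^sub>R d j)) \<le> e * (\<Sum>j\<in>I. \<bar>y j - x' j\<bar>)"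
  proof (rule insert.IH)
    show "y j = x' j" if "j \<notin> I" for j using insert.prems(1)[of j] that by (auto simp: x'_def)
    fix z j assume j: "j \<in> I" and z: "\<And>k. z k \<in> closed_segment (x' k) (y k)"
    have "z k \<in> closed_segment (x k) (y k)" for k
      using z[of k] by (cases "k = i") (auto simp: x'_def)
    then show "((\<lambda>t. F (z(j := t))) has_vector_derivative D j z) (at (z j)) \<and> norm (D j z - d j) \<le> e"
      using insert.prems(2)[of j z] j by blast
  qed
  then have 1: "norm (F y - F x' - (\<Sum>j\<in>I. (y j - x j) *\<^sub>R d j)) \<le> e * (\<Sum>j\<in>I. \<bar>y j - x j\<bar>)"
    using x'I by simp
  let ?h = "\<lambda>t. F (x(i := t)) - (t - x i) *\<^sub>R d i"
  have 2: "norm (?h (y i) - ?h (x i)) \<le> e * norm (y i - x i)"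
  proof (rule differentiable_bound[where S = "closed_segment (x i) (y i)"])
    fix t assume t: "t \<in> closed_segment (x i) (y i)"
    let ?z = "x(i := t)"
    have "\<And>j. ?z j \<in> closed_segment (x j) (y j)" using t by auto
    from insert.prems(2)[OF _ this, of i]
    have D: "((\<lambda>s. F (x(i := s))) has_vector_derivative D i ?z) (at t)" "norm (D i ?z - d i) \<le> e"
      by (simp_all del: fun_upd_apply add: fun_upd_same)
    have "(?h has_vector_derivative D i ?z - d i) (at t)"
      by (auto intro!: derivative_eq_intros D(1))
    then show "(?h has_derivative (\<lambda>s. s *\<^sub>R (D i ?z - d i))) (at t within closed_segment (x i) (y i))"
      unfolding has_vector_derivative_def by (rule has_derivative_at_withinI)
    show "onorm (\<lambda>s. s *\<^sub>R (D i ?z - d i)) \<le> e"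
      using D(2) by (subst onorm_scaleR_left) (auto simp: onorm_id bounded_linear_ident)
  qed auto
  have eq: "F y - F x - (\<Sum>j\<in>insert i I. (y j - x j) *\<^sub>R d j)
     = (F y - F x' - (\<Sum>j\<in>I. (y j - x j) *\<^sub>R d j)) + (?h (y i) - ?h (x i))"
    using insert.hyps by (simp add: x'_def algebra_simps)
  have "norm (F y - F x - (\<Sum>j\<in>insert i I. (y j - x j) *\<^sub>R d j))
     \<le> e * (\<Sum>j\<in>I. \<bar>y j - x j\<bar>) + e * norm (y i - x i)"
    unfolding eq by (rule norm_triangle_mono[OF 1 2])
  also have "\<dots> = e * (\<Sum>j\<in>insert i I. \<bar>y j - x j\<bar>)"
    using insert.hyps by (simp add: algebra_simps)
  finally show ?case .
qed

lemma Ck_on_continuous: "Ck_on k I U F \<Longrightarrow> continuous_on U F"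
  by (cases k) auto

lemma Ck_on_SucD: "Ck_on (Suc k) I U F \<Longrightarrow> Ck_on k I U F"
  by (induction k arbitrary: F) auto

lemma Ck_on_mono:
  assumes "Ck_on k I U F" "j \<le> k"
  shows "Ck_on j I U F"
  using assms(2,1) by (induction rule: inc_induct) (blast dest: Ck_on_SucD)+

lemma Ck_on_partial:
  assumes "Ck_on (Suc k) I U F" "i \<in> I" "p \<in> U"
  shows "((\<lambda>t. F (p(i := t))) has_vector_derivative partial_deriv i F p) (at (p i))"
  using assms by (auto simp: partial_deriv_def vector_derivative_works)

text \<open>
  Strict differentiability at \<open>p\<close>: by continuity the partial derivatives vary by at most \<open>e\<close> in a
  small box around \<open>p\<close>, so that \<open>mean_value_coordinatewise\<close> applies with their values at \<open>p\<close> as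
  slopes. Letting both points vary yields local Lipschitz continuity as well as differentiability.
\<close>

lemma C1_linearization:
  fixes F :: "('i \<Rightarrow> real) \<Rightarrow> 'b::real_normed_vector"
  assumes "finite I" "coord_open I U" "Ck_on (Suc 0) I U F" "p \<in> U" "e > 0"
  shows "\<exists>\<delta>>0. coord_box I p \<delta> \<subseteq> U \<and> (\<forall>x\<in>coord_box I p \<delta>. \<forall>y\<in>coord_box I p \<delta>.
     norm (F y - F x - (\<Sum>i\<in>I. (y i - x i) *\<^sub>R partial_deriv i F p)) \<le> e * (\<Sum>i\<in>I. \<bar>y i - x i\<bar>))"
proof -
  have "\<exists>W. open W \<and> p \<in> W \<and> (\<forall>y\<in>U \<inter> W. norm (partial_deriv i F y - partial_deriv i F p) < e)"
    if "i \<in> I" for i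
  proof -
    have "continuous_on U (partial_deriv i F)" using assms(3) that by auto
    then have "\<exists>A. open A \<and> p \<in> A \<and> (\<forall>y\<in>U. y \<in> A \<longrightarrow> partial_deriv i F y \<in> ball (partial_deriv i F p) e)"
      using assms(4,5) unfolding continuous_on_topological by (meson centre_in_ball open_ball)
    then show ?thesis by (metis IntE dist_commute dist_norm mem_ball)
  qed
  then obtain W where W: "\<And>i. i \<in> I \<Longrightarrow> open (W i) \<and> p \<in> W i"
    "\<And>i y. i \<in> I \<Longrightarrow> y \<in> U \<Longrightarrow> y \<in> W i \<Longrightarrow> norm (partial_deriv i F y - partial_deriv i F p) < e"
    by (metis IntI)
  have "open (\<Inter>i\<in>I. W i)" "p \<in> (\<Inter>i\<in>I. W i)" using W assms(1) by auto
  from open_contains_coord_box[OF this, of I] obtain \<delta>1 where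
    \<delta>1: "\<delta>1 > 0" "coord_box I p \<delta>1 \<subseteq> (\<Inter>i\<in>I. W i)" by blast
  obtain \<delta>2 where \<delta>2: "\<delta>2 > 0" "coord_box I p \<delta>2 \<subseteq> U" using assms by (auto simp: coord_open_def)
  define \<delta> where "\<delta> = min \<delta>1 \<delta>2"
  have sub: "coord_box I p \<delta> \<subseteq> U" "coord_box I p \<delta> \<subseteq> (\<Inter>i\<in>I. W i)"
    using \<delta>1(2) \<delta>2(2) coord_box_mono[of \<delta> \<delta>1 I p] coord_box_mono[of \<delta> \<delta>2 I p]
    by (auto simp: \<delta>_def)
  have "norm (F y - F x - (\<Sum>i\<in>I. (y i - x i) *\<^sub>R partial_deriv i F p)) \<le> e * (\<Sum>i\<in>I. \<bar>y i - x i\<bar>)"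
    if xy: "x \<in> coord_box I p \<delta>" "y \<in> coord_box I p \<delta>" for x y
  proof (rule mean_value_coordinatewise[OF assms(1)])
    show "y i = x i" if "i \<notin> I" for i using xy that by (auto simp: coord_box_def)
    fix z i assume i: "i \<in> I" and "\<And>j. z j \<in> closed_segment (x j) (y j)"
    then have "z \<in> coord_box I p \<delta>" using coord_box_between[OF xy] by blast
    then have "z \<in> U" "z \<in> W i" using sub i by blast+
    then show "((\<lambda>t. F (z(i := t))) has_vector_derivative partial_deriv i F z) (at (z i)) \<and>
       norm (partial_deriv i F z - partial_deriv i F p) \<le> e"
      using Ck_on_partial[OF assms(3) i] W(2)[OF i] by (auto intro: less_imp_le)
  qed
  moreover have "\<delta> > 0" using \<delta>1 \<delta>2 by (auto simp: \<delta>_def)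
  ultimately show ?thesis using sub(1) by blast
qed

lemma C1_locally_Lipschitz:
  fixes F :: "('i \<Rightarrow> real) \<Rightarrow> 'b::real_normed_vector"
  assumes "finite I" "coord_open I U" "Ck_on (Suc 0) I U F" "p \<in> U"
  shows "\<exists>\<delta>>0. \<exists>L\<ge>0. coord_box I p \<delta> \<subseteq> U \<and> (\<forall>x\<in>coord_box I p \<delta>. \<forall>y\<in>coord_box I p \<delta>.
     norm (F x - F y) \<le> L * (\<Sum>i\<in>I. \<bar>x i - y i\<bar>))"
proof -
  obtain \<delta> where \<delta>: "\<delta> > 0" "coord_box I p \<delta> \<subseteq> U" "\<And>x y. x \<in> coord_box I p \<delta> \<Longrightarrow> y\<in>coord_box I p \<delta> \<Longrightarrow>
     norm (F x - F y - (\<Sum>i\<in>I. (x i - y i) *\<^sub>R partial_deriv i F p)) \<le> 1 * (\<Sum>i\<in>I. \<bar>x i - y i\<bar>)"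
    using C1_linearization[OF assms, of 1] by auto
  define M where "M = (\<Sum>i\<in>I. norm (partial_deriv i F p))"
  have "norm (F x - F y) \<le> (1 + M) * (\<Sum>i\<in>I. \<bar>x i - y i\<bar>)"
    if "x \<in> coord_box I p \<delta>" "y\<in>coord_box I p \<delta>" for x y
  proof -
    have "norm (\<Sum>i\<in>I. (x i - y i) *\<^sub>R partial_deriv i F p) \<le> (\<Sum>i\<in>I. \<bar>x i - y i\<bar> * M)"
      by (rule sum_norm_le) (auto simp: M_def assms(1) intro!: mult_left_mono member_le_sum)
    also have "\<dots> = M * (\<Sum>i\<in>I. \<bar>x i - y i\<bar>)" by (simp add: sum_distrib_left mult.commute)
    finally show ?thesis using \<delta>(3)[OF that] norm_triangle_sub[of "F x - F y" "\<Sum>i\<in>I. (x i - y i) *\<^sub>R partial_deriv i F p"]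
      by (simp add: algebra_simps)
  qed
  moreover have "1 + M \<ge> 0" by (auto simp: M_def sum_nonneg add_nonneg_nonneg)
  ultimately show ?thesis using \<delta>(1,2) by blast
qed

text \<open>
  A chain rule along curves suffices, since partial derivatives of a composition are derivatives along
  the images of coordinate lines. The error \<open>R\<close> of the linearization of \<open>G\<close> along the curve has
  derivative \<open>0\<close>, because \<open>c t - c t0\<close> is of size at most \<open>K \<bar>t - t0\<bar>\<close> for \<open>t\<close> near \<open>t0\<close>.
\<close>

lemma C1_chain_rule:
  fixes G :: "('j \<Rightarrow> real) \<Rightarrow> 'b::real_normed_vector"
  assumes J: "finite J" "coord_open J W" and G: "Ck_on (Suc 0) J W G"
    and w: "c t0 \<in> W"
    and stay: "\<forall>\<^sub>F t in nhds t0. \<forall>j. j \<notin> J \<longrightarrow> c t j = c t0 j"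
    and c': "\<And>j. j \<in> J \<Longrightarrow> ((\<lambda>t. c t j) has_vector_derivative c' j) (at t0)"
  shows "((\<lambda>t. G (c t)) has_vector_derivative (\<Sum>j\<in>J. c' j *\<^sub>R partial_deriv j G (c t0))) (at t0)"
proof -
  let ?d = "\<lambda>j. partial_deriv j G (c t0)"
  define R where "R t = G (c t) - G (c t0) - (\<Sum>j\<in>J. (c t j - c t0 j) *\<^sub>R ?d j)" for t
  \<comment> \<open>A Lipschitz constant for the curve at \<open>t0\<close>; the extra \<open>1\<close> keeps it positive when \<open>J\<close> is empty.\<close>
  define K where "K = 1 + (\<Sum>j\<in>J. \<bar>c' j\<bar> + 1)"
  have K: "K > 0" unfolding K_def by (smt (verit) sum_nonneg)
  have c_lip: "\<forall>\<^sub>F t in nhds t0. \<bar>c t j - c t0 j\<bar> \<le> (\<bar>c' j\<bar> + 1) * \<bar>t - t0\<bar>" if "j \<in> J" for j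
  proof -
    obtain d where d: "d > 0" "\<And>t. norm (t - t0) < d \<Longrightarrow>
        norm (c t j - c t0 j - (t - t0) *\<^sub>R c' j) \<le> 1 * norm (t - t0)"
      using c'[OF \<open>j \<in> J\<close>] unfolding has_vector_derivative_def has_derivative_at_alt
      by (meson zero_less_one)
    have "\<bar>c t j - c t0 j\<bar> \<le> (\<bar>c' j\<bar> + 1) * \<bar>t - t0\<bar>" if "dist t t0 < d" for t
    proof -
      have "\<bar>c t j - c t0 j - (t - t0) * c' j\<bar> \<le> \<bar>t - t0\<bar>"
        using d(2)[of t] that by (simp add: dist_real_def)
      moreover have "\<bar>(t - t0) * c' j\<bar> = \<bar>c' j\<bar> * \<bar>t - t0\<bar>" by (simp add: abs_mult)
      ultimately show ?thesis by (simp add: distrib_right)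
    qed
    then show ?thesis using d(1) unfolding eventually_nhds_metric by blast
  qed
  have "(R has_derivative (\<lambda>h. 0)) (at t0)"
    unfolding has_derivative_at_alt
  proof (intro conjI allI impI bounded_linear_zero)
    fix e :: real assume e: "e > 0"
    obtain \<delta> where \<delta>: "\<delta> > 0" "\<And>x y. x \<in> coord_box J (c t0) \<delta> \<Longrightarrow> y \<in> coord_box J (c t0) \<delta> \<Longrightarrow>
        norm (G y - G x - (\<Sum>j\<in>J. (y j - x j) *\<^sub>R ?d j)) \<le> e / K * (\<Sum>j\<in>J. \<bar>y j - x j\<bar>)"
      using C1_linearization[OF J G w, of "e / K"] e K by auto
    have near: "\<forall>\<^sub>F t in nhds t0. \<bar>t - t0\<bar> < \<delta> / K"
      unfolding eventually_nhds_metric dist_real_def using \<delta>(1) K by (intro exI[of _ "\<delta> / K"]) auto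
    have "\<forall>\<^sub>F t in nhds t0. \<forall>j\<in>J. \<bar>c t j - c t0 j\<bar> \<le> (\<bar>c' j\<bar> + 1) * \<bar>t - t0\<bar>"
      using c_lip J(1) by (simp add: eventually_ball_finite)
    with stay near have "\<forall>\<^sub>F t in nhds t0. norm (R t) \<le> e * \<bar>t - t0\<bar>"
    proof eventually_elim
      case (elim t)
      have cj: "\<bar>c' j\<bar> + 1 \<le> K - 1" if "j \<in> J" for j
        unfolding K_def using that J(1) member_le_sum[of j J "\<lambda>j. \<bar>c' j\<bar> + 1"] by auto
      have "c t \<in> coord_box J (c t0) \<delta>"
        unfolding coord_box_def
      proof (intro CollectI conjI ballI allI impI)
        fix j assume j: "j \<in> J"
        have "\<bar>c t j - c t0 j\<bar> \<le> K * \<bar>t - t0\<bar>"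
          using elim(3) j cj[OF j] mult_right_mono[of "\<bar>c' j\<bar> + 1" K "\<bar>t - t0\<bar>"] by force
        also have "\<dots> < \<delta>" using elim(2) K by (simp add: field_simps)
        finally show "\<bar>c t j - c t0 j\<bar> < \<delta>" .
      qed (use elim(1) in auto)
      from \<delta>(2)[OF coord_box_self[OF \<delta>(1)] this]
      have R: "norm (R t) \<le> e / K * (\<Sum>j\<in>J. \<bar>c t j - c t0 j\<bar>)" by (simp add: R_def)
      have "(\<Sum>j\<in>J. \<bar>c t j - c t0 j\<bar>) \<le> (\<Sum>j\<in>J. (\<bar>c' j\<bar> + 1) * \<bar>t - t0\<bar>)"
        using elim(3) by (intro sum_mono) auto
      also have "\<dots> = (K - 1) * \<bar>t - t0\<bar>" by (simp add: K_def sum_distrib_right)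
      also have "\<dots> \<le> K * \<bar>t - t0\<bar>" by (intro mult_right_mono) auto
      finally have "e / K * (\<Sum>j\<in>J. \<bar>c t j - c t0 j\<bar>) \<le> e / K * (K * \<bar>t - t0\<bar>)"
        using e K by (intro mult_left_mono) auto
      also have "\<dots> = e * \<bar>t - t0\<bar>" using K by simp
      finally show ?case using R by linarith
    qed
    then obtain d where "d > 0" "\<And>t. dist t t0 < d \<Longrightarrow> norm (R t) \<le> e * \<bar>t - t0\<bar>"
      unfolding eventually_nhds_metric by blast
    moreover have "R t0 = 0" by (simp add: R_def)
    ultimately show "\<exists>d>0. \<forall>y. norm (y - t0) < d \<longrightarrow> norm (R y - R t0 - 0) \<le> e * norm (y - t0)"
      by (intro exI[of _ d]) (auto simp: dist_real_def)
  qed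
  then have R': "(R has_vector_derivative 0) (at t0)" by (simp add: has_vector_derivative_def)
  have "((\<lambda>t. R t + G (c t0) + (\<Sum>j\<in>J. (c t j - c t0 j) *\<^sub>R ?d j)) has_vector_derivative
      (0 + 0 + (\<Sum>j\<in>J. c' j *\<^sub>R ?d j))) (at t0)"
  proof (intro has_vector_derivative_add has_vector_derivative_sum R' has_vector_derivative_const)
    fix j assume "j \<in> J"
    have "((\<lambda>t. c t j - c t0 j) has_vector_derivative c' j) (at t0)"
      using c'[OF \<open>j \<in> J\<close>] by (auto intro!: derivative_eq_intros)
    then show "((\<lambda>t. (c t j - c t0 j) *\<^sub>R ?d j) has_vector_derivative c' j *\<^sub>R ?d j) (at t0)"
      by (rule bounded_linear.has_vector_derivative[OF bounded_linear_scaleR_left])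
  qed
  then show ?thesis by (simp add: R_def)
qed

lemma has_partial_cong:
  assumes "coord_open I U" "\<And>q. q \<in> U \<Longrightarrow> F q = G q" "p \<in> U" "i \<in> I"
  shows "((\<lambda>t. F (p(i := t))) has_vector_derivative D) (at (p i)) \<longleftrightarrow>
         ((\<lambda>t. G (p(i := t))) has_vector_derivative D) (at (p i))"
proof (rule has_vector_derivative_cong_ev)
  show "\<forall>\<^sub>F t in nhds (p i). t \<in> UNIV \<longrightarrow> F (p(i := t)) = G (p(i := t))"
    using eventually_coord_open[OF assms(1,3,4)] assms(2) by (auto elim!: eventually_mono)
qed (simp add: assms(2,3))

lemma partial_deriv_cong:
  assumes "coord_open I U" "\<And>q. q \<in> U \<Longrightarrow> F q = G q" "p \<in> U" "i \<in> I"
  shows "partial_deriv i F p = partial_deriv i G p"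
  using has_partial_cong[where F = F and G = G, OF assms] unfolding partial_deriv_def vector_derivative_def by simp

lemma Ck_on_cong:
  assumes "coord_open I U" "\<And>q. q \<in> U \<Longrightarrow> F q = G q" "Ck_on k I U F"
  shows "Ck_on k I U G"
  using assms(2,3)
proof (induction k arbitrary: F G)
  case 0
  then show ?case using continuous_on_cong[of U U F G] by simp
next
  case (Suc k)
  have "continuous_on U G" using Suc.prems continuous_on_cong[of U U F G] by simp
  moreover have "(\<lambda>t. G (x(i := t))) differentiable at (x i)" if "i \<in> I" "x \<in> U" for i x
    using Ck_on_partial[OF Suc.prems(2) that] has_partial_cong[where F = F and G = G, OF assms(1) Suc.prems(1) that(2,1)]
    by (blast intro: differentiableI_vector)
  moreover have "Ck_on k I U (partial_deriv i G)" if "i \<in> I" for i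
  proof (rule Suc.IH)
    show "partial_deriv i F q = partial_deriv i G q" if "q \<in> U" for q
      using partial_deriv_cong[where F = F and G = G, OF assms(1) Suc.prems(1) that \<open>i \<in> I\<close>] .
    show "Ck_on k I U (partial_deriv i F)" using Suc.prems(2) that by simp
  qed
  ultimately show ?case by simp
qed

text \<open>
  Functions \<open>D i\<close> that agree with the partial derivatives on \<open>U\<close> are as good as \<open>partial_deriv i F\<close>,
  whose values outside of \<open>U\<close> are arbitrary. The closure of \<open>C\<^sup>k\<close> under sums of two functions, bounded
  linear maps, products and compositions follows by induction on \<open>k\<close> from this rule and an explicit
  formula for \<open>D\<close>.
\<close>

lemma Ck_on_SucI:
  assumes "coord_open I U" "continuous_on U F"
    and "\<And>i p. i \<in> I \<Longrightarrow> p \<in> U \<Longrightarrow> ((\<lambda>t. F (p(i := t))) has_vector_derivative D i p) (at (p i))"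
    and "\<And>i. i \<in> I \<Longrightarrow> Ck_on k I U (D i)"
  shows "Ck_on (Suc k) I U F"
proof -
  have "Ck_on k I U (partial_deriv i F)" if "i \<in> I" for i
    unfolding partial_deriv_def using vector_derivative_at[OF assms(3)[OF that]]
    by (intro Ck_on_cong[OF assms(1) _ assms(4)[OF that]]) simp
  then show ?thesis using assms(2,3) by (auto intro: differentiableI_vector)
qed

lemma Ck_on_const:
  assumes "coord_open I U"
  shows "Ck_on k I U (\<lambda>p. c)"
proof (induction k arbitrary: c)
  case (Suc k)
  then show ?case by (intro Ck_on_SucI[OF assms, where D = "\<lambda>i p. 0"]) auto
qed auto

lemma Ck_on_add:
  assumes "coord_open I U" "Ck_on k I U F" "Ck_on k I U G"
  shows "Ck_on k I U (\<lambda>p. F p + G p)"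
  using assms(2,3)
proof (induction k arbitrary: F G)
  case 0
  then show ?case by (auto intro: continuous_on_add)
next
  case (Suc k)
  show ?case
  proof (rule Ck_on_SucI[OF assms(1), where D = "\<lambda>i p. partial_deriv i F p + partial_deriv i G p"])
    show "continuous_on U (\<lambda>p. F p + G p)" using Suc.prems by (auto intro: continuous_on_add)
    show "Ck_on k I U (\<lambda>p. partial_deriv i F p + partial_deriv i G p)" if "i \<in> I" for i
      using Suc.prems that by (intro Suc.IH) auto
  qed (intro has_vector_derivative_add Ck_on_partial[OF Suc.prems(1)] Ck_on_partial[OF Suc.prems(2)])
qed

lemma Ck_on_sum:
  assumes "coord_open I U" "finite J" "\<And>j. j \<in> J \<Longrightarrow> Ck_on k I U (F j)"
  shows "Ck_on k I U (\<lambda>p. \<Sum>j\<in>J. F j p)"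
  using assms(2,3)
  by (induction J) (simp_all add: Ck_on_const[OF assms(1)] Ck_on_add[OF assms(1)])

lemma Ck_on_bounded_linear:
  assumes "coord_open I U" "bounded_linear T" "Ck_on k I U F"
  shows "Ck_on k I U (\<lambda>p. T (F p))"
  using assms(3)
proof (induction k arbitrary: F)
  case 0
  then show ?case using assms(2) by (simp add: bounded_linear.continuous_on)
next
  case (Suc k)
  show ?case
  proof (rule Ck_on_SucI[OF assms(1), where D = "\<lambda>i p. T (partial_deriv i F p)"])
    show "continuous_on U (\<lambda>p. T (F p))"
      using Suc.prems assms(2) by (auto intro: bounded_linear.continuous_on)
    show "Ck_on k I U (\<lambda>p. T (partial_deriv i F p))" if "i \<in> I" for i
      using Suc.prems that by (intro Suc.IH) auto
  qed (intro bounded_linear.has_vector_derivative[OF assms(2)] Ck_on_partial[OF Suc.prems])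
qed

lemma Ck_on_scaleR:
  fixes a :: "('i \<Rightarrow> real) \<Rightarrow> real"
  assumes "coord_open I U" "Ck_on k I U a" "Ck_on k I U F"
  shows "Ck_on k I U (\<lambda>p. a p *\<^sub>R F p)"
  using assms(2,3)
proof (induction k arbitrary: a F)
  case 0
  then show ?case by (auto intro: continuous_on_scaleR)
next
  case (Suc k)
  show ?case
  proof (rule Ck_on_SucI[OF assms(1), where D = "\<lambda>i p. a p *\<^sub>R partial_deriv i F p + partial_deriv i a p *\<^sub>R F p"])
    show "continuous_on U (\<lambda>p. a p *\<^sub>R F p)" using Suc.prems by (auto intro: continuous_on_scaleR)
    show "Ck_on k I U (\<lambda>p. a p *\<^sub>R partial_deriv i F p + partial_deriv i a p *\<^sub>R F p)" if "i \<in> I" for i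
      using Suc.prems that
      by (intro Ck_on_add[OF assms(1)] Suc.IH) (use Ck_on_SucD[OF Suc.prems(1)] Ck_on_SucD[OF Suc.prems(2)] in auto)
    fix i p assume ip: "i \<in> I" "p \<in> U"
    have "((\<lambda>t. a (p(i := t))) has_field_derivative partial_deriv i a p) (at (p i))"
      unfolding has_real_derivative_iff_has_vector_derivative
      by (rule Ck_on_partial[OF Suc.prems(1) ip])
    from has_vector_derivative_scaleR[OF this Ck_on_partial[OF Suc.prems(2) ip]]
    show "((\<lambda>t. a (p(i := t)) *\<^sub>R F (p(i := t))) has_vector_derivative
        a p *\<^sub>R partial_deriv i F p + partial_deriv i a p *\<^sub>R F p) (at (p i))"
      by (simp only: fun_upd_triv)
  qed
qed

text \<open>
  The map \<open>\<tau>\<close> takes values in the coordinates \<open>J\<close>; the remaining ones are pinned to fixed values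
  \<open>e j\<close>, which are \<open>0\<close> for a coordinate change of a manifold.
\<close>

lemma partial_deriv_compose:
  fixes G :: "('j \<Rightarrow> real) \<Rightarrow> 'b::real_normed_vector"
  assumes "finite J" "coord_open J W" "coord_open I U"
    and "\<tau> ` U \<subseteq> W" "\<And>p j. p \<in> U \<Longrightarrow> j \<notin> J \<Longrightarrow> \<tau> p j = e j"
    and "\<And>j. j \<in> J \<Longrightarrow> Ck_on (Suc 0) I U (\<lambda>p. \<tau> p j)" "Ck_on (Suc 0) J W G"
    and "p \<in> U" "i \<in> I"
  shows "((\<lambda>t. G (\<tau> (p(i := t)))) has_vector_derivative
    (\<Sum>j\<in>J. partial_deriv i (\<lambda>p. \<tau> p j) p *\<^sub>R partial_deriv j G (\<tau> p))) (at (p i))"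
proof -
  have "((\<lambda>t. G (\<tau> (p(i := t)))) has_vector_derivative
    (\<Sum>j\<in>J. partial_deriv i (\<lambda>p. \<tau> p j) p *\<^sub>R partial_deriv j G (\<tau> (p(i := p i))))) (at (p i))"
  proof (rule C1_chain_rule[OF assms(1,2,7), where c = "\<lambda>t. \<tau> (p(i := t))"])
    show "\<tau> (p(i := p i)) \<in> W" using assms(4,8) by auto
    show "\<forall>\<^sub>F t in nhds (p i). \<forall>j. j \<notin> J \<longrightarrow> \<tau> (p(i := t)) j = \<tau> (p(i := p i)) j"
      using eventually_coord_open[OF assms(3,8,9)] assms(5,8) by (auto elim!: eventually_mono)
    show "((\<lambda>t. \<tau> (p(i := t)) j) has_vector_derivative partial_deriv i (\<lambda>p. \<tau> p j) p) (at (p i))"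
      if "j \<in> J" for j
      using Ck_on_partial[OF assms(6)[OF that] assms(9,8)] .
  qed
  then show ?thesis by simp
qed

text \<open>
  By the chain rule, a partial derivative of \<open>G \<circ> \<tau>\<close> is a sum of products of partial derivatives of \<open>\<tau>\<close>
  with partial derivatives of \<open>G\<close> composed with \<open>\<tau>\<close>. The induction hypothesis covers the
  latter, so \<open>G\<close> has to vary in the induction.
\<close>

lemma Ck_on_compose:
  fixes G :: "('j \<Rightarrow> real) \<Rightarrow> 'b::real_normed_vector"
  assumes "finite J" "coord_open J W" "coord_open I U"
    and "\<tau> ` U \<subseteq> W" "\<And>p j. p \<in> U \<Longrightarrow> j \<notin> J \<Longrightarrow> \<tau> p j = e j"
    and "\<And>j. j \<in> J \<Longrightarrow> Ck_on k I U (\<lambda>p. \<tau> p j)" "Ck_on k J W G"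
  shows "Ck_on k I U (\<lambda>p. G (\<tau> p))"
  using assms(6,7)
proof (induction k arbitrary: G)
  case 0
  have cont: "continuous_on U \<tau>"
  proof (rule continuous_on_coordinatewise_then_product)
    show "continuous_on U (\<lambda>p. \<tau> p j)" for j
      using 0(1)[of j] assms(5) continuous_on_cong[of U U "\<lambda>p. \<tau> p j" "\<lambda>p. e j"]
      by (cases "j \<in> J") auto
  qed
  then show ?case
    using 0(2) continuous_on_compose2[of W G U \<tau>] assms(4) by auto
next
  case (Suc k)
  have k: "Ck_on k I U (\<lambda>p. \<tau> p j)" if "j \<in> J" for j
    using Suc.prems(1)[OF that] by (rule Ck_on_SucD)
  have 1: "Ck_on (Suc 0) I U (\<lambda>p. \<tau> p j)" if "j \<in> J" for j
    using Suc.prems(1)[OF that] by (rule Ck_on_mono) simp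
  have 2: "Ck_on (Suc 0) J W G" using Suc.prems(2) by (rule Ck_on_mono) simp
  have "Ck_on k I U (\<lambda>p. G (\<tau> p))"
    using Suc.IH[OF k Ck_on_SucD[OF Suc.prems(2)]] .
  then have "continuous_on U (\<lambda>p. G (\<tau> p))" by (rule Ck_on_continuous)
  then show ?case
  proof (rule Ck_on_SucI[OF assms(3)])
    fix i assume i: "i \<in> I"
    show "((\<lambda>t. G (\<tau> (p(i := t)))) has_vector_derivative
        (\<Sum>j\<in>J. partial_deriv i (\<lambda>p. \<tau> p j) p *\<^sub>R partial_deriv j G (\<tau> p))) (at (p i))" if "p \<in> U" for p
      by (rule partial_deriv_compose[OF assms(1-5) 1 2 that i])
    show "Ck_on k I U (\<lambda>p. \<Sum>j\<in>J. partial_deriv i (\<lambda>p. \<tau> p j) p *\<^sub>R partial_deriv j G (\<tau> p))"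
    proof (intro Ck_on_sum[OF assms(3,1)] Ck_on_scaleR[OF assms(3)])
      fix j assume j: "j \<in> J"
      show "Ck_on k I U (partial_deriv i (\<lambda>p. \<tau> p j))" using Suc.prems(1)[OF j] i by simp
      show "Ck_on k I U (\<lambda>p. partial_deriv j G (\<tau> p))"
        using Suc.prems(2) j by (intro Suc.IH[OF k]) auto
    qed
  qed
qed

section \<open>Double points and critical points in charts\<close>

text \<open>
  Inside \<open>Euclidean_space n\<close> the coordinates from \<open>n\<close> on vanish, so an open cube of the product topology
  cuts out exactly a coordinate box.
\<close>

lemma C1_locally_Lipschitz_wrt:
  fixes F :: "(nat \<Rightarrow> real) \<Rightarrow> 'b::real_normed_vector"
  assumes "coord_open {..<n} U" "Ck_on (Suc 0) {..<n} U F" "U \<subseteq> topspace (Euclidean_space n)"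
  shows "locally_Lipschitz_wrt {..<n} (\<lambda>i p. p i) U F"
  unfolding locally_Lipschitz_wrt_def
proof
  fix p assume p: "p \<in> U"
  obtain \<delta> L where \<delta>: "\<delta> > 0" "L \<ge> 0" and lip: "\<And>x y. x \<in> coord_box {..<n} p \<delta> \<Longrightarrow> y \<in> coord_box {..<n} p \<delta> \<Longrightarrow>
      norm (F x - F y) \<le> L * (\<Sum>i<n. \<bar>x i - y i\<bar>)"
    using C1_locally_Lipschitz[OF finite_lessThan assms(1,2) p] by meson
  define W where "W = {y. \<forall>i\<in>{..<n}. \<bar>y i - p i\<bar> < \<delta>}"
  define B where "B = norm (F p) + L * (real n * \<delta>)"
  have box: "x \<in> coord_box {..<n} p \<delta>" if "x \<in> U \<inter> W" for x
  proof -
    have "x i = 0" "p i = 0" if "i \<notin> {..<n}" for i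
      using assms(3) p \<open>x \<in> U \<inter> W\<close> that by (auto simp: topspace_Euclidean_space)
    then show ?thesis using that by (auto simp: coord_box_def W_def)
  qed
  have pW: "p \<in> W" using \<delta>(1) by (simp add: W_def)
  have 1: "norm (F x) \<le> B" if "x \<in> U \<inter> W" for x
  proof -
    have "p \<in> U \<inter> W" using p pW by simp
    from lip[OF box[OF that] box[OF this]]
    have "norm (F x - F p) \<le> L * (\<Sum>i<n. \<bar>x i - p i\<bar>)" .
    also have "\<dots> \<le> L * (\<Sum>i<n. \<delta>)"
      using that \<delta>(2) by (intro mult_left_mono sum_mono) (auto simp: W_def intro: less_imp_le)
    finally show ?thesis using norm_triangle_sub[of "F x" "F p"] by (simp add: B_def)
  qed
  have 2: "norm (F x - F y) \<le> (B + L) * (\<Sum>i<n. \<bar>x i - y i\<bar>)" if "x \<in> U \<inter> W" "y \<in> U \<inter> W" for x y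
  proof -
    have "B \<ge> 0" using \<delta> by (simp add: B_def)
    then have "L * (\<Sum>i<n. \<bar>x i - y i\<bar>) \<le> (B + L) * (\<Sum>i<n. \<bar>x i - y i\<bar>)"
      by (intro mult_right_mono sum_nonneg) auto
    then show ?thesis using lip[OF box[OF that(1)] box[OF that(2)]] by linarith
  qed
  have "open W" unfolding W_def by (rule open_coord_cube) simp
  moreover have "norm (F x) \<le> B + L" if "x \<in> U \<inter> W" for x using 1[OF that] \<delta>(2) by linarith
  ultimately show "\<exists>W L. open W \<and> p \<in> W \<and> (\<forall>x\<in>U \<inter> W. norm (F x) \<le> L) \<and>
     (\<forall>x\<in>U \<inter> W. \<forall>y\<in>U \<inter> W. norm (F x - F y) \<le> L * (\<Sum>i\<in>{..<n}. \<bar>x i - y i\<bar>))"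
    using pW 2 by (intro exI[of _ W] exI[of _ "B + L"]) blast
qed

definition pair_coord :: "nat + nat \<Rightarrow> (nat \<Rightarrow> real) \<times> (nat \<Rightarrow> real) \<Rightarrow> real" where
  "pair_coord = case_sum (\<lambda>i q. fst q i) (\<lambda>i q. snd q i)"

lemma continuous_on_pair_coord: "continuous_on UNIV (pair_coord z)"
proof -
  have "continuous_on UNIV (\<lambda>q :: (nat \<Rightarrow> real) \<times> (nat \<Rightarrow> real). fst q i)"
    "continuous_on UNIV (\<lambda>q :: (nat \<Rightarrow> real) \<times> (nat \<Rightarrow> real). snd q i)" for i
    by (rule continuous_on_product_then_coordinatewise,
        rule continuous_on_fst continuous_on_snd, rule continuous_on_id)+
  then show ?thesis by (cases z) (simp_all add: pair_coord_def)
qed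

lemma sum_pair_coord:
  "(\<Sum>z\<in>{..<n} <+> {..<n}. \<bar>pair_coord z x - pair_coord z y\<bar>) =
     (\<Sum>i<n. \<bar>fst x i - fst y i\<bar>) + (\<Sum>i<n. \<bar>snd x i - snd y i\<bar>)"
  by (subst sum.Plus) (auto simp: pair_coord_def)

lemma locally_Lipschitz_wrt_fst:
  assumes "locally_Lipschitz_wrt {..<n} (\<lambda>i p. p i) U F" "fst ` Q \<subseteq> U"
  shows "locally_Lipschitz_wrt ({..<n} <+> {..<n}) pair_coord Q (\<lambda>q. F (fst q))"
  by (rule locally_Lipschitz_wrt_pullback[OF assms(1) _ assms(2)])
     (auto simp: sum_pair_coord intro!: continuous_on_fst continuous_on_snd continuous_on_id sum_nonneg)

lemma locally_Lipschitz_wrt_snd: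
  assumes "locally_Lipschitz_wrt {..<n} (\<lambda>i p. p i) U F" "snd ` Q \<subseteq> U"
  shows "locally_Lipschitz_wrt ({..<n} <+> {..<n}) pair_coord Q (\<lambda>q. F (snd q))"
  by (rule locally_Lipschitz_wrt_pullback[OF assms(1) _ assms(2)])
     (auto simp: sum_pair_coord intro!: continuous_on_fst continuous_on_snd continuous_on_id sum_nonneg)

text \<open>
  Coincidence of the images of \<open>p\<close> and \<open>p'\<close> means that \<open>M\<close> maps \<open>F p - F' p'\<close>, which is not zero, to
  \<open>G' p' - G p\<close>. Two charts occur because the two points need not lie in a common one.
\<close>

lemma double_points_null:
  fixes F F' :: "(nat \<Rightarrow> real) \<Rightarrow> real ^ 'm" and G G' :: "(nat \<Rightarrow> real) \<Rightarrow> real ^ 'l"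
  assumes s: "2 * real n + (real CARD('m) - 1) * real CARD('l) < s"
    and U: "coord_open {..<n} U" "U \<subseteq> topspace (Euclidean_space n)"
    and U': "coord_open {..<n} U'" "U' \<subseteq> topspace (Euclidean_space n)"
    and F: "Ck_on (Suc 0) {..<n} U F" "Ck_on (Suc 0) {..<n} U' F'"
    and G: "Ck_on (Suc 0) {..<n} U G" "Ck_on (Suc 0) {..<n} U' G'"
  shows "hausdorff_null s {M :: real ^ 'm ^ 'l. \<exists>p\<in>U. \<exists>p'\<in>U'. F p \<noteq> F' p' \<and>
           G p + M *v F p = G' p' + M *v F' p'}"
proof -
  define Q where "Q = {(p, p'). p \<in> U \<and> p' \<in> U' \<and> F p \<noteq> F' p'}"
  have Q: "fst ` Q \<subseteq> U" "snd ` Q \<subseteq> U'" by (auto simp: Q_def)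
  have "hausdorff_null s {M :: real ^ 'm ^ 'l. \<exists>q\<in>Q. M *v (F (fst q) - F' (snd q)) = G' (snd q) - G (fst q)}"
  proof (rule incidence_null[where J = "{..<n} <+> {..<n}" and c = pair_coord])
    show "real (card ({..<n} <+> {..<n})) + (real CARD('m) - 1) * real CARD('l) < s"
      using s by (simp add: card_Plus)
    show "locally_Lipschitz_wrt ({..<n} <+> {..<n}) pair_coord Q (\<lambda>q. F (fst q) - F' (snd q))"
      by (rule locally_Lipschitz_wrt_diff[OF
        locally_Lipschitz_wrt_fst[OF C1_locally_Lipschitz_wrt[OF U(1) F(1) U(2)] Q(1)]
        locally_Lipschitz_wrt_snd[OF C1_locally_Lipschitz_wrt[OF U'(1) F(2) U'(2)] Q(2)]])
    show "locally_Lipschitz_wrt ({..<n} <+> {..<n}) pair_coord Q (\<lambda>q. G' (snd q) - G (fst q))"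
      by (rule locally_Lipschitz_wrt_diff[OF
        locally_Lipschitz_wrt_snd[OF C1_locally_Lipschitz_wrt[OF U'(1) G(2) U'(2)] Q(2)]
        locally_Lipschitz_wrt_fst[OF C1_locally_Lipschitz_wrt[OF U(1) G(1) U(2)] Q(1)]])
  qed (auto simp: Q_def)
  moreover have "{M :: real ^ 'm ^ 'l. \<exists>p\<in>U. \<exists>p'\<in>U'. F p \<noteq> F' p' \<and> G p + M *v F p = G' p' + M *v F' p'}
      \<subseteq> {M. \<exists>q\<in>Q. M *v (F (fst q) - F' (snd q)) = G' (snd q) - G (fst q)}"
  proof
    fix M :: "real ^ 'm ^ 'l"
    assume "M \<in> {M. \<exists>p\<in>U. \<exists>p'\<in>U'. F p \<noteq> F' p' \<and> G p + M *v F p = G' p' + M *v F' p'}"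
    then obtain p p' where pp: "p \<in> U" "p' \<in> U'" "F p \<noteq> F' p'" and eq: "G p + M *v F p = G' p' + M *v F' p'"
      by auto
    have "M *v (F p - F' p') = G' p' - G p"
      using eq by (simp add: matrix_vector_mult_diff_distrib algebra_simps)
    moreover have "(p, p') \<in> Q" using pp by (simp add: Q_def)
    ultimately show "M \<in> {M. \<exists>q\<in>Q. M *v (F (fst q) - F' (snd q)) = G' (snd q) - G (fst q)}" by force
  qed
  ultimately show ?thesis by (rule hausdorff_null_subset)
qed

text \<open>
  The differential is a sum of products of the coordinates of \<open>v\<close> with partial derivatives of \<open>F\<close>,
  and the latter are of class \<open>C\<^sup>1\<close> because \<open>F\<close> is of class \<open>C\<^sup>2\<close>.
\<close>

lemma coord_differential_locally_Lipschitz_wrt: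
  fixes F :: "(nat \<Rightarrow> real) \<Rightarrow> 'b::real_normed_vector"
  assumes U: "coord_open {..<n} U" "U \<subseteq> topspace (Euclidean_space n)"
    and F: "Ck_on 2 {..<n} U F" and Q: "fst ` Q \<subseteq> U"
  shows "locally_Lipschitz_wrt ({..<n} <+> {..<n}) pair_coord Q (\<lambda>q. coord_differential n F (fst q) (snd q))"
  unfolding coord_differential_def
proof (intro locally_Lipschitz_wrt_sum locally_Lipschitz_wrt_scaleR)
  fix i assume i: "i \<in> {..<n}"
  have "locally_Lipschitz_wrt ({..<n} <+> {..<n}) pair_coord Q (pair_coord (Inr i))"
    using i by (intro locally_Lipschitz_wrt_coord continuous_on_pair_coord) auto
  then show "locally_Lipschitz_wrt ({..<n} <+> {..<n}) pair_coord Q (\<lambda>q. snd q i)"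
    by (simp add: pair_coord_def)
  have "Ck_on (Suc 0) {..<n} U (partial_deriv i F)" using F i by (simp add: numeral_2_eq_2)
  then show "locally_Lipschitz_wrt ({..<n} <+> {..<n}) pair_coord Q (\<lambda>q. partial_deriv i F (fst q))"
    by (rule locally_Lipschitz_wrt_fst[OF C1_locally_Lipschitz_wrt[OF U(1) _ U(2)] Q])
qed auto

text \<open>
  Each failure of injectivity of the differential is an incidence with the \<open>2 n\<close> parameters \<open>(p, v)\<close>.
  Normalizing \<open>v\<close> would save one parameter, but double points take \<open>2 n\<close> parameters anyway.
\<close>

lemma critical_points_null:
  fixes F :: "(nat \<Rightarrow> real) \<Rightarrow> real ^ 'm" and G :: "(nat \<Rightarrow> real) \<Rightarrow> real ^ 'l"
  assumes s: "2 * real n + (real CARD('m) - 1) * real CARD('l) < s"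
    and U: "coord_open {..<n} U" "U \<subseteq> topspace (Euclidean_space n)"
    and F: "Ck_on 2 {..<n} U F" and G: "Ck_on 2 {..<n} U G"
  shows "hausdorff_null s {M :: real ^ 'm ^ 'l. \<exists>p\<in>U. \<exists>v. coord_differential n F p v \<noteq> 0 \<and>
           coord_differential n G p v + M *v coord_differential n F p v = 0}"
proof -
  define Q where "Q = {(p, v). p \<in> U \<and> coord_differential n F p v \<noteq> 0}"
  have Q: "fst ` Q \<subseteq> U" by (auto simp: Q_def)
  have "hausdorff_null s {M :: real ^ 'm ^ 'l. \<exists>q\<in>Q.
      M *v coord_differential n F (fst q) (snd q) = 0 - coord_differential n G (fst q) (snd q)}"
  proof (rule incidence_null[where J = "{..<n} <+> {..<n}" and c = pair_coord])
    show "real (card ({..<n} <+> {..<n})) + (real CARD('m) - 1) * real CARD('l) < s"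
      using s by (simp add: card_Plus)
    show "locally_Lipschitz_wrt ({..<n} <+> {..<n}) pair_coord Q (\<lambda>q. coord_differential n F (fst q) (snd q))"
      by (rule coord_differential_locally_Lipschitz_wrt[OF U F Q])
    show "locally_Lipschitz_wrt ({..<n} <+> {..<n}) pair_coord Q (\<lambda>q. 0 - coord_differential n G (fst q) (snd q))"
      by (intro locally_Lipschitz_wrt_diff locally_Lipschitz_wrt_zero
          coord_differential_locally_Lipschitz_wrt[OF U G Q])
  qed (auto simp: Q_def)
  moreover have "{M :: real ^ 'm ^ 'l. \<exists>p\<in>U. \<exists>v. coord_differential n F p v \<noteq> 0 \<and>
           coord_differential n G p v + M *v coord_differential n F p v = 0} \<subseteq> {M. \<exists>q\<in>Q.
      M *v coord_differential n F (fst q) (snd q) = 0 - coord_differential n G (fst q) (snd q)}"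
    by (force simp: Q_def eq_neg_iff_add_eq_0 add.commute)
  ultimately show ?thesis by (rule hausdorff_null_subset)
qed

section \<open>Embeddings of compact manifolds\<close>

lemma is_chartD:
  assumes "is_chart n X (U, \<phi>)"
  shows "openin X U" "inj_on \<phi> U" "\<phi> ` U \<subseteq> topspace (Euclidean_space n)"
    and "coord_open {..<n} (\<phi> ` U)"
    and "\<And>W. openin X W \<Longrightarrow> coord_open {..<n} (\<phi> ` (U \<inter> W))"
proof -
  have U: "openin X U" and \<phi>U: "openin (Euclidean_space n) (\<phi> ` U)"
    and hom: "homeomorphic_map (subtopology X U) (subtopology (Euclidean_space n) (\<phi> ` U)) \<phi>"
    using assms by (auto simp: is_chart_def)
  show "openin X U" by (fact U)
  have "topspace (subtopology X U) = U" using openin_subset[OF U] by auto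
  then show "inj_on \<phi> U" using homeomorphic_imp_injective_map[OF hom] by simp
  show "\<phi> ` U \<subseteq> topspace (Euclidean_space n)" by (rule openin_subset[OF \<phi>U])
  show "coord_open {..<n} (\<phi> ` U)" by (rule coord_open_Euclidean_space[OF \<phi>U])
  fix W assume W: "openin X W"
  have "openin (subtopology X U) (U \<inter> W)"
    by (rule openin_subtopology_Int2[OF W])
  then have "openin (subtopology (Euclidean_space n) (\<phi> ` U)) (\<phi> ` (U \<inter> W))"
    using homeomorphic_imp_open_map[OF hom] by (auto simp: open_map_def)
  then have "openin (Euclidean_space n) (\<phi> ` (U \<inter> W))"
    using openin_trans_full[OF _ \<phi>U] by blast
  then show "coord_open {..<n} (\<phi> ` (U \<inter> W))" by (rule coord_open_Euclidean_space)
qed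

lemma Cr_manifold_chart:
  assumes "Cr_manifold r n X A" "(U, \<phi>) \<in> A"
  shows "is_chart n X (U, \<phi>)"
  using assms by (auto simp: Cr_manifold_def)

lemma Cr_mapD:
  assumes "Cr_map r n A h" "(U, \<phi>) \<in> A" "enat k \<le> r"
  shows "Ck_on k {..<n} (\<phi> ` U) (h \<circ> inv_into U \<phi>)"
  using assms by (auto simp: Cr_map_def Cr_on_def)

lemma Cr_mapI:
  assumes "\<And>U \<phi> k. (U, \<phi>) \<in> A \<Longrightarrow> enat k \<le> r \<Longrightarrow> Ck_on k {..<n} (\<phi> ` U) (h \<circ> inv_into U \<phi>)"
  shows "Cr_map r n A h"
  using assms by (auto simp: Cr_map_def Cr_on_def)

lemma Cr_map_add:
  assumes "Cr_manifold r n X A" "Cr_map r n A h" "Cr_map r n A h'"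
  shows "Cr_map r n A (\<lambda>x. h x + h' x)"
proof (rule Cr_mapI)
  fix U \<phi> k assume c: "(U, \<phi>) \<in> A" "enat k \<le> r"
  have "Ck_on k {..<n} (\<phi> ` U) (\<lambda>p. (h \<circ> inv_into U \<phi>) p + (h' \<circ> inv_into U \<phi>) p)"
    using is_chartD(4)[OF Cr_manifold_chart[OF assms(1) c(1)]] Cr_mapD[OF assms(2) c] Cr_mapD[OF assms(3) c]
    by (rule Ck_on_add)
  then show "Ck_on k {..<n} (\<phi> ` U) ((\<lambda>x. h x + h' x) \<circ> inv_into U \<phi>)" by (simp add: comp_def)
qed

lemma Cr_map_bounded_linear:
  assumes "Cr_manifold r n X A" "bounded_linear T" "Cr_map r n A h"
  shows "Cr_map r n A (\<lambda>x. T (h x))"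
proof (rule Cr_mapI)
  fix U \<phi> k assume c: "(U, \<phi>) \<in> A" "enat k \<le> r"
  have "Ck_on k {..<n} (\<phi> ` U) (\<lambda>p. T ((h \<circ> inv_into U \<phi>) p))"
    using is_chartD(4)[OF Cr_manifold_chart[OF assms(1) c(1)]] assms(2) Cr_mapD[OF assms(3) c]
    by (rule Ck_on_bounded_linear)
  then show "Ck_on k {..<n} (\<phi> ` U) ((\<lambda>x. T (h x)) \<circ> inv_into U \<phi>)" by (simp add: comp_def)
qed

text \<open>
  Read in a chart, the components of \<open>f\<close> supply the coordinate functions to which \<open>Ck_on_compose\<close>
  applies.
\<close>

lemma Cr_map_compose_vec:
  fixes f :: "'x \<Rightarrow> real ^ 'm" and g :: "real ^ 'm \<Rightarrow> 'b::real_normed_vector"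
  assumes "Cr_manifold r n X A" "open V" "f ` topspace X \<subseteq> V" "Cr_map r n A f" "Cr_on_vec r V g"
  shows "Cr_map r n A (g \<circ> f)"
proof (rule Cr_mapI)
  fix U \<phi> k assume c: "(U, \<phi>) \<in> A" "enat k \<le> r"
  note ch = is_chartD[OF Cr_manifold_chart[OF assms(1) c(1)]]
  let ?\<tau> = "\<lambda>p. vec_nth (f (inv_into U \<phi> p))"
  have "Ck_on k {..<n} (\<phi> ` U) (\<lambda>p. (g \<circ> vec_lambda) (?\<tau> p))"
  proof (rule Ck_on_compose[where J = UNIV and W = "vec_nth ` V"])
    have "f (inv_into U \<phi> p) \<in> V" if "p \<in> \<phi> ` U" for p
      using inv_into_into[OF that] openin_subset[OF ch(1)] assms(3) by auto
    then show "?\<tau> ` (\<phi> ` U) \<subseteq> vec_nth ` V" by auto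
    show "Ck_on k UNIV (vec_nth ` V) (g \<circ> vec_lambda)"
      using assms(5) c(2) by (simp add: Cr_on_vec_def Cr_on_def)
    show "Ck_on k {..<n} (\<phi> ` U) (\<lambda>p. f (inv_into U \<phi> p) $ j)" for j
      using Ck_on_bounded_linear[OF ch(4) bounded_linear_vec_nth Cr_mapD[OF assms(4) c]]
      by (simp add: comp_def)
  qed (auto intro: coord_open_vec assms(2) ch(4))
  then show "Ck_on k {..<n} (\<phi> ` U) ((g \<circ> f) \<circ> inv_into U \<phi>)" by (simp add: comp_def)
qed

lemma Cr_on_vec_continuous_on:
  assumes "Cr_on_vec r V g"
  shows "continuous_on V g"
proof -
  have "Ck_on 0 UNIV (vec_nth ` V) (g \<circ> vec_lambda)"
    using assms by (simp only: Cr_on_vec_def Cr_on_def) (metis i0_lb zero_enat_def)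
  then have "continuous_on (vec_nth ` V) (g \<circ> vec_lambda)" by simp
  moreover have "continuous_on V vec_nth"
    by (rule continuous_on_coordinatewise_then_product) (rule bounded_linear.continuous_on[OF bounded_linear_vec_nth continuous_on_id])
  ultimately have "continuous_on V (\<lambda>x. (g \<circ> vec_lambda) (vec_nth x))"
    by (rule continuous_on_compose2) simp
  then show ?thesis by simp
qed

text \<open>
  The derivative of the coordinate change from \<open>c\<close> to \<open>c'\<close> at \<open>p\<close>, extended by \<open>0\<close> so that it takes
  values in \<open>Euclidean_space n\<close>.
\<close>

definition transition_differential ::
    "nat \<Rightarrow> 'x chart \<Rightarrow> 'x chart \<Rightarrow> (nat \<Rightarrow> real) \<Rightarrow> (nat \<Rightarrow> real) \<Rightarrow> nat \<Rightarrow> real" where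
  "transition_differential n c c' p v j = (if j < n then
     coord_differential n (\<lambda>q. snd c' (inv_into (fst c) (snd c) q) j) p v else 0)"

text \<open>
  Near \<open>\<phi> x\<close> the coordinate expression of \<open>H\<close> in the first chart is the one in the second chart composed with
  the coordinate change. The transformed vector is the same for every \<open>H\<close>, which is what allows a
  comparison of \<open>f\<close> with \<open>(g + \<pi>) \<circ> f\<close>.
\<close>

lemma coord_differential_transition:
  assumes M: "Cr_manifold r n X A" and r: "enat (Suc 0) \<le> r"
    and c: "(U, \<phi>) \<in> A" and c': "(W, \<psi>) \<in> A" and x: "x \<in> U" "x \<in> W"
    and H: "Cr_map r n A H"
  shows "coord_differential n (H \<circ> inv_into U \<phi>) (\<phi> x) v =
    coord_differential n (H \<circ> inv_into W \<psi>) (\<psi> x) (transition_differential n (U, \<phi>) (W, \<psi>) (\<phi> x) v)"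
proof -
  note ch = is_chartD[OF Cr_manifold_chart[OF M c]]
  note ch' = is_chartD[OF Cr_manifold_chart[OF M c']]
  let ?\<tau> = "\<lambda>q. \<psi> (inv_into U \<phi> q)"
  let ?UW = "\<phi> ` (U \<inter> W)"
  let ?D = "\<lambda>i j. partial_deriv i (\<lambda>q. ?\<tau> q j) (\<phi> x)"
  let ?G = "H \<circ> inv_into W \<psi>"
  have inv: "inv_into U \<phi> (\<phi> y) = y" if "y \<in> U" for y using ch(2) that by simp
  have inv': "inv_into W \<psi> (\<psi> y) = y" if "y \<in> W" for y using ch'(2) that by simp
  have op: "coord_open {..<n} ?UW" by (rule ch(5)[OF ch'(1)])
  have xUW: "\<phi> x \<in> ?UW" using x by auto
  have "partial_deriv i (H \<circ> inv_into U \<phi>) (\<phi> x) = (\<Sum>j<n. ?D i j *\<^sub>R partial_deriv j ?G (\<psi> x))"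
    if i: "i \<in> {..<n}" for i
  proof -
    have "((\<lambda>t. ?G (?\<tau> ((\<phi> x)(i := t)))) has_vector_derivative
        (\<Sum>j<n. ?D i j *\<^sub>R partial_deriv j ?G (?\<tau> (\<phi> x)))) (at (\<phi> x i))"
    proof (rule partial_deriv_compose[OF finite_lessThan ch'(4) op _ _ _ Cr_mapD[OF H c' r] xUW i])
      show "?\<tau> ` ?UW \<subseteq> \<psi> ` W" using inv by auto
      show "?\<tau> p j = 0" if "p \<in> ?UW" "j \<notin> {..<n}" for p j
        using that inv ch'(3) by (auto simp: topspace_Euclidean_space)
      show "Ck_on (Suc 0) {..<n} ?UW (\<lambda>p. ?\<tau> p j)" if "j \<in> {..<n}" for j
        using M c c' that r unfolding Cr_manifold_def Cr_on_def by fastforce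
    qed
    moreover have "?G (?\<tau> q) = (H \<circ> inv_into U \<phi>) q" if "q \<in> ?UW" for q
      using that inv inv' by auto
    ultimately have "((\<lambda>t. (H \<circ> inv_into U \<phi>) ((\<phi> x)(i := t))) has_vector_derivative
        (\<Sum>j<n. ?D i j *\<^sub>R partial_deriv j ?G (?\<tau> (\<phi> x)))) (at (\<phi> x i))"
      using has_partial_cong[where F = "\<lambda>q. ?G (?\<tau> q)" and G = "H \<circ> inv_into U \<phi>", OF op _ xUW i] by blast
    then show ?thesis
      unfolding partial_deriv_def[of i "H \<circ> inv_into U \<phi>"] using inv[OF x(1)]
      by (simp only: vector_derivative_at)
  qed
  then have "coord_differential n (H \<circ> inv_into U \<phi>) (\<phi> x) v
      = (\<Sum>i<n. v i *\<^sub>R (\<Sum>j<n. ?D i j *\<^sub>R partial_deriv j ?G (\<psi> x)))"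
    unfolding coord_differential_def by (intro sum.cong refl) simp
  also have "\<dots> = (\<Sum>j<n. \<Sum>i<n. (v i * ?D i j) *\<^sub>R partial_deriv j ?G (\<psi> x))"
    by (subst sum.swap) (simp add: scaleR_sum_right)
  also have "\<dots> = (\<Sum>j<n. (\<Sum>i<n. v i * ?D i j) *\<^sub>R partial_deriv j ?G (\<psi> x))"
    by (simp only: scaleR_sum_left)
  also have "\<dots> = coord_differential n ?G (\<psi> x) (transition_differential n (U, \<phi>) (W, \<psi>) (\<phi> x) v)"
    unfolding coord_differential_def transition_differential_def by (intro sum.cong refl) simp
  finally show ?thesis .
qed

lemma inj_on_coord_differential_iff:
  "inj_on (coord_differential n F p) (topspace (Euclidean_space n)) \<longleftrightarrow>
     (\<forall>v\<in>topspace (Euclidean_space n). coord_differential n F p v = 0 \<longrightarrow> v = (\<lambda>_. 0))"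
proof
  have z: "coord_differential n F p (\<lambda>_. 0) = 0" by (simp add: coord_differential_def)
  have z': "(\<lambda>_. 0) \<in> topspace (Euclidean_space n)" by (simp add: topspace_Euclidean_space)
  show "\<forall>v\<in>topspace (Euclidean_space n). coord_differential n F p v = 0 \<longrightarrow> v = (\<lambda>_. 0)"
    if "inj_on (coord_differential n F p) (topspace (Euclidean_space n))"
    using inj_onD[OF that _ _ z'] z by simp
next
  assume ker: "\<forall>v\<in>topspace (Euclidean_space n). coord_differential n F p v = 0 \<longrightarrow> v = (\<lambda>_. 0)"
  show "inj_on (coord_differential n F p) (topspace (Euclidean_space n))"
  proof (rule inj_onI)
    fix v w assume vw: "v \<in> topspace (Euclidean_space n)" "w \<in> topspace (Euclidean_space n)"
      and eq: "coord_differential n F p v = coord_differential n F p w"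
    have "coord_differential n F p (\<lambda>i. v i - w i) = 0"
      using eq by (simp add: coord_differential_def scaleR_diff_left sum_subtractf)
    moreover have "(\<lambda>i. v i - w i) \<in> topspace (Euclidean_space n)"
      using vw by (simp add: topspace_Euclidean_space)
    ultimately have "(\<lambda>i. v i - w i) = (\<lambda>_. 0)" using ker by blast
    then show "v = w" by (metis eq_iff_diff_eq_0 ext)
  qed
qed

lemma coord_differential_add_linear:
  assumes "Ck_on (Suc 0) {..<n} U F" "Ck_on (Suc 0) {..<n} U G" "p \<in> U" "bounded_linear T"
  shows "coord_differential n (\<lambda>p. G p + T (F p)) p v = coord_differential n G p v + T (coord_differential n F p v)"
proof -
  interpret T: bounded_linear T by fact
  have "partial_deriv i (\<lambda>p. G p + T (F p)) p = partial_deriv i G p + T (partial_deriv i F p)" if "i \<in> {..<n}" for i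
    unfolding partial_deriv_def[of i "\<lambda>p. G p + T (F p)"]
    by (intro vector_derivative_at has_vector_derivative_add Ck_on_partial[OF assms(2) that assms(3)]
        bounded_linear.has_vector_derivative[OF assms(4)] Ck_on_partial[OF assms(1) that assms(3)])
  then show ?thesis
    unfolding coord_differential_def
    by (simp add: scaleR_add_right sum.distrib T.sum T.scaleR)
qed

lemma embedding_map_imp_inj_continuous:
  assumes "embedding_map X Y f"
  shows "inj_on f (topspace X)" "continuous_map X Y f"
  using assms unfolding embedding_map_def
  by (auto dest: homeomorphic_imp_injective_map homeomorphic_imp_continuous_map
      intro: continuous_map_into_fulltopology)

text \<open>
  If the differential of \<open>(g + T) \<circ> f\<close> kills \<open>v\<close> in some chart, then in a chart of the subatlas \<open>A'\<close> it
  kills the transformed vector \<open>w\<close>. By \<open>no_critical\<close> the differential of \<open>f\<close> kills \<open>w\<close>, hence it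
  kills \<open>v\<close> in the original chart, and \<open>v = 0\<close> because \<open>f\<close> is an immersion. Injectivity follows from
  \<open>no_double\<close> and the injectivity of \<open>f\<close>, and compactness turns it into an embedding.
\<close>

lemma Cr_embedding_perturbationI:
  fixes f :: "'x \<Rightarrow> real ^ 'm" and g :: "real ^ 'm \<Rightarrow> real ^ 'l"
  assumes r: "enat (Suc 0) \<le> r"
    and M: "Cr_manifold r n X A" "compact_space X"
    and V: "open V" "f ` topspace X \<subseteq> V" and f: "Cr_embedding r n X A f"
    and g: "Cr_on_vec r V g"
    and A': "A' \<subseteq> A" "topspace X \<subseteq> (\<Union>c\<in>A'. fst c)"
    and T: "bounded_linear T"
    and no_double: "\<And>x y. x \<in> topspace X \<Longrightarrow> y \<in> topspace X \<Longrightarrow> f x \<noteq> f y \<Longrightarrow> g (f x) + T (f x) \<noteq> g (f y) + T (f y)"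
    and no_critical: "\<And>U \<phi> x v. (U, \<phi>) \<in> A' \<Longrightarrow> x \<in> U \<Longrightarrow> coord_differential n (f \<circ> inv_into U \<phi>) (\<phi> x) v \<noteq> 0 \<Longrightarrow>
      coord_differential n (g \<circ> f \<circ> inv_into U \<phi>) (\<phi> x) v + T (coord_differential n (f \<circ> inv_into U \<phi>) (\<phi> x) v) \<noteq> 0"
  shows "Cr_embedding r n X A ((\<lambda>v. g v + T v) \<circ> f)"
proof -
  let ?h = "(\<lambda>v. g v + T v) \<circ> f"
  have fC: "Cr_map r n A f" and femb: "embedding_map X euclidean f"
    and fimm: "\<And>U \<phi> x. (U, \<phi>) \<in> A \<Longrightarrow> x \<in> U \<Longrightarrow>
        inj_on (coord_differential n (f \<circ> inv_into U \<phi>) (\<phi> x)) (topspace (Euclidean_space n))"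
    using f by (auto simp: Cr_embedding_def Cr_immersion_def)
  note f_inj = embedding_map_imp_inj_continuous(1)[OF femb]
  note f_cont = embedding_map_imp_inj_continuous(2)[OF femb]
  have gfC: "Cr_map r n A (g \<circ> f)" by (rule Cr_map_compose_vec[OF M(1) V fC g])
  have hC: "Cr_map r n A ?h"
    using Cr_map_add[OF M(1) gfC Cr_map_bounded_linear[OF M(1) T fC]] by (simp add: comp_def)
  have imm: "inj_on (coord_differential n (?h \<circ> inv_into U \<phi>) (\<phi> x)) (topspace (Euclidean_space n))"
    if c: "(U, \<phi>) \<in> A" "x \<in> U" for U \<phi> x
    unfolding inj_on_coord_differential_iff
  proof (intro ballI impI)
    fix v assume v: "v \<in> topspace (Euclidean_space n)"
      and v0: "coord_differential n (?h \<circ> inv_into U \<phi>) (\<phi> x) v = 0"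
    have "x \<in> topspace X"
      using openin_subset[OF is_chartD(1)[OF Cr_manifold_chart[OF M(1) c(1)]]] c(2) by auto
    then obtain W \<psi> where W: "(W, \<psi>) \<in> A'" "x \<in> W" using A'(2) by fastforce
    then have WA: "(W, \<psi>) \<in> A" using A'(1) by auto
    define w where "w = transition_differential n (U, \<phi>) (W, \<psi>) (\<phi> x) v"
    note tr = coord_differential_transition[OF M(1) r c(1) WA c(2) W(2), of _ v, folded w_def]
    have "(?h \<circ> inv_into W \<psi>) = (\<lambda>p. (g \<circ> f \<circ> inv_into W \<psi>) p + T ((f \<circ> inv_into W \<psi>) p))"
      by (simp add: fun_eq_iff)
    then have "coord_differential n (g \<circ> f \<circ> inv_into W \<psi>) (\<psi> x) w
        + T (coord_differential n (f \<circ> inv_into W \<psi>) (\<psi> x) w) = 0"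
      using v0 tr[OF hC] W(2)
        coord_differential_add_linear[OF Cr_mapD[OF fC WA r] Cr_mapD[OF gfC WA r] _ T, of "\<psi> x" w]
      by simp
    then have "coord_differential n (f \<circ> inv_into W \<psi>) (\<psi> x) w = 0"
      using no_critical[OF W] by blast
    then have "coord_differential n (f \<circ> inv_into U \<phi>) (\<phi> x) v = 0" using tr[OF fC] by simp
    then show "v = (\<lambda>_. 0)" using fimm[OF c] v unfolding inj_on_coord_differential_iff by blast
  qed
  have "embedding_map X euclidean ?h"
  proof (rule continuous_imp_embedding_map[OF _ M(2)])
    have "continuous_on V (\<lambda>v. g v + T v)"
      using Cr_on_vec_continuous_on[OF g] bounded_linear.continuous_on[OF T continuous_on_id]
      by (rule continuous_on_add)
    moreover have "continuous_map X (top_of_set V) f"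
      using f_cont V(2) by (auto simp: continuous_map_in_subtopology)
    ultimately show "continuous_map X euclidean ?h"
      by (intro continuous_map_compose[of X "top_of_set V"]) (simp_all add: continuous_map_iff_continuous)
    show "inj_on ?h (topspace X)"
      using no_double f_inj by (auto simp: inj_on_def)
  qed auto
  then show ?thesis using hC imm by (auto simp: Cr_embedding_def Cr_immersion_def)
qed

theorem corollary5p17:
  fixes r :: enat and n :: nat
    and X :: "'x topology" and A :: "'x chart set"
    and V :: "(real ^ 'm) set"
    and f :: "'x \<Rightarrow> real ^ 'm" and g :: "real ^ 'm \<Rightarrow> real ^ 'l"
    and s :: real
  assumes "2 \<le> r"
    and "Cr_manifold r n X A" and "compact_space X"
    and "2 * n < CARD('l)"
    and "open V"
    and "f ` topspace X \<subseteq> V" and "Cr_embedding r n X A f"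
    and "Cr_on_vec r V g"
    and "real CARD('m) * real CARD('l) + 2 * real n - real CARD('l) < s"
  shows "linear_maps_hausdorff_null s
           {\<pi>. linear \<pi> \<and> \<not> Cr_embedding r n X A ((\<lambda>v. g v + \<pi> v) \<circ> f)}"
proof -
  have r2: "enat 2 \<le> r" using assms(1) by (simp add: numeral_eq_enat)
  have r1: "enat (Suc 0) \<le> r" using r2 by (rule order_trans[rotated]) simp
  have s: "2 * real n + (real CARD('m) - 1) * real CARD('l) < s"
    using assms(9) by (simp add: algebra_simps)
  have "0 \<le> (real CARD('m) - 1) * real CARD('l)"
    by (intro mult_nonneg_nonneg) (simp_all add: Suc_leI)
  then have s0: "s \<noteq> 0" using s by linarith
  note M = assms(2)
  have fC: "Cr_map r n A f" using assms(7) by (auto simp: Cr_embedding_def Cr_immersion_def)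
  have gfC: "Cr_map r n A (g \<circ> f)" by (rule Cr_map_compose_vec[OF M assms(5,6) fC assms(8)])
  have "\<forall>U\<in>fst ` A. openin X U"
    using is_chartD(1)[OF Cr_manifold_chart[OF M]] by auto
  moreover have cover: "topspace X \<subseteq> \<Union>(fst ` A)"
    using M by (auto simp: Cr_manifold_def case_prod_unfold)
  ultimately obtain \<F> where \<F>: "finite \<F>" "\<F> \<subseteq> fst ` A" "topspace X \<subseteq> \<Union>\<F>"
    using assms(3) unfolding compact_space_alt by meson
  obtain A' where A': "A' \<subseteq> A" "finite A'" "\<F> = fst ` A'"
    using finite_subset_image[OF \<F>(1,2)] by blast
  let ?F = "\<lambda>c :: 'x chart. f \<circ> inv_into (fst c) (snd c)"
  let ?G = "\<lambda>c :: 'x chart. (g \<circ> f) \<circ> inv_into (fst c) (snd c)"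
  let ?U = "\<lambda>c :: 'x chart. snd c ` fst c"
  define Double where "Double = (\<lambda>(c, c'). {M :: real ^ 'm ^ 'l. \<exists>p\<in>?U c. \<exists>p'\<in>?U c'. ?F c p \<noteq> ?F c' p' \<and>
      ?G c p + M *v ?F c p = ?G c' p' + M *v ?F c' p'})"
  define Critical where "Critical c = {M :: real ^ 'm ^ 'l. \<exists>p\<in>?U c. \<exists>v. coord_differential n (?F c) p v \<noteq> 0 \<and>
      coord_differential n (?G c) p v + M *v coord_differential n (?F c) p v = 0}" for c
  have chart: "coord_open {..<n} (?U c)" "?U c \<subseteq> topspace (Euclidean_space n)"
    "\<And>k. enat k \<le> r \<Longrightarrow> Ck_on k {..<n} (?U c) (?F c)" "\<And>k. enat k \<le> r \<Longrightarrow> Ck_on k {..<n} (?U c) (?G c)"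
    if "c \<in> A'" for c
  proof -
    have c: "(fst c, snd c) \<in> A" using that A'(1) by auto
    note ch = is_chartD[OF Cr_manifold_chart[OF M c]]
    show "coord_open {..<n} (?U c)" "?U c \<subseteq> topspace (Euclidean_space n)" by (rule ch(4), rule ch(3))
    show "Ck_on k {..<n} (?U c) (?F c)" "Ck_on k {..<n} (?U c) (?G c)" if "enat k \<le> r" for k
      using Cr_mapD[OF fC c that] Cr_mapD[OF gfC c that] by auto
  qed
  have "hausdorff_null s (\<Union>S\<in>Double ` (A' \<times> A') \<union> Critical ` A'. S)"
  proof (rule hausdorff_null_UN)
    show "countable (Double ` (A' \<times> A') \<union> Critical ` A')" using A'(2) by (auto intro: countable_finite)
    fix S assume "S \<in> Double ` (A' \<times> A') \<union> Critical ` A'"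
    then consider c c' where "c \<in> A'" "c' \<in> A'" "S = Double (c, c')" | c where "c \<in> A'" "S = Critical c" by auto
    then show "hausdorff_null s S"
    proof cases
      case 1
      then show ?thesis unfolding 1(3) Double_def prod.case
        by (intro double_points_null[OF s] chart r1)
    next
      case 2
      then show ?thesis unfolding 2(2) Critical_def
        by (intro critical_points_null[OF s] chart r2)
    qed
  qed
  moreover have "matrix ` {\<pi>. linear \<pi> \<and> \<not> Cr_embedding r n X A ((\<lambda>v. g v + \<pi> v) \<circ> f)}
      \<subseteq> (\<Union>S\<in>Double ` (A' \<times> A') \<union> Critical ` A'. S)"
  proof (rule image_subsetI, rule ccontr)
    fix \<pi> assume "\<pi> \<in> {\<pi>. linear \<pi> \<and> \<not> Cr_embedding r n X A ((\<lambda>v. g v + \<pi> v) \<circ> f)}"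
      and good: "matrix \<pi> \<notin> (\<Union>S\<in>Double ` (A' \<times> A') \<union> Critical ` A'. S)"
    then have \<pi>: "linear \<pi>" and bad: "\<not> Cr_embedding r n X A ((\<lambda>v. g v + \<pi> v) \<circ> f)" by auto
    have mat: "matrix \<pi> *v x = \<pi> x" for x by (rule fun_cong[OF matrix_vector_mul(2)[OF \<pi>]])
    have good_Double: "matrix \<pi> \<notin> Double (c, c')" if "c \<in> A'" "c' \<in> A'" for c c' using good that by auto
    have good_Critical: "matrix \<pi> \<notin> Critical c" if "c \<in> A'" for c using good that by auto
    have inv: "inv_into (fst c) (snd c) (snd c x) = x" if "c \<in> A'" "x \<in> fst c" for c x
      using is_chartD(2)[OF Cr_manifold_chart[OF M, of "fst c" "snd c"]] that A'(1) by auto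
    have "Cr_embedding r n X A ((\<lambda>v. g v + \<pi> v) \<circ> f)"
    proof (rule Cr_embedding_perturbationI[OF r1 M assms(3,5-8) A'(1)])
      show "topspace X \<subseteq> (\<Union>c\<in>A'. fst c)" using \<F>(3) A'(3) by simp
      show "bounded_linear \<pi>" using \<pi> by (simp add: linear_conv_bounded_linear)
      show "g (f x) + \<pi> (f x) \<noteq> g (f y) + \<pi> (f y)"
        if xy: "x \<in> topspace X" "y \<in> topspace X" "f x \<noteq> f y" for x y
      proof
        assume eq: "g (f x) + \<pi> (f x) = g (f y) + \<pi> (f y)"
        obtain c c' where c: "c \<in> A'" "x \<in> fst c" "c' \<in> A'" "y \<in> fst c'"
          using xy \<F>(3) A'(3) by blast
        have "matrix \<pi> \<in> Double (c, c')"
          unfolding Double_def prod.case mem_Collect_eq mat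
          using c xy(3) eq by (intro bexI[of _ "snd c x"] bexI[of _ "snd c' y"]) (auto simp: inv)
        then show False using good_Double c by blast
      qed
      show "coord_differential n (g \<circ> f \<circ> inv_into U \<phi>) (\<phi> x) v + \<pi> (coord_differential n (f \<circ> inv_into U \<phi>) (\<phi> x) v) \<noteq> 0"
        if "(U, \<phi>) \<in> A'" "x \<in> U" "coord_differential n (f \<circ> inv_into U \<phi>) (\<phi> x) v \<noteq> 0" for U \<phi> x v
        using good_Critical[OF that(1)] that(2,3) by (auto simp: Critical_def mat)
    qed
    then show False using bad by contradiction
  qed
  ultimately have "hausdorff_null s (matrix ` {\<pi>. linear \<pi> \<and> \<not> Cr_embedding r n X A ((\<lambda>v. g v + \<pi> v) \<circ> f)})"
    by (rule hausdorff_null_subset)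
  then show ?thesis
    unfolding linear_maps_hausdorff_null_def by (rule hausdorff_outer_measure_eq_0[OF s0])
qed

end
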